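(* For every positive integer $d$, $\Delta_d=W([d])$ as operators on $\mathbb{C}[p_1,p_2,\dots]$.
   Context: Let $X=(X_{ab})_{a,b\ge1}$ be an infinite matrix of commuting indeterminates, $p_k=\mathrm{tr}(X^k)$, and regard $\mathbb{C}[p_1,p_2,\dots]\subset\mathbb{C}[[X_{ab}]]$. Define \[ W([d])=\frac1d\sum_{a_1,\dots,a_d\ge1}\ \sum_{e_1,\dots,e_d\ge1}\ \prod_{i=1}^d X_{a_ie_i}\ \prod_{i=1}^d\frac{\partial}{\partial X_{a_{i+1}e_i}},\qquad a_{d+1}=a_1, \] which is known to preserve $\mathbb{C}[p_1,p_2,\dots]$. For $\delta\in S_d$ with disjoint cycle decomposition $\delta=\delta_1\cdots\delta_m$ (fixed points included as $1$-cycles) and positive integers $a_1,\dots,a_d$, set $\hat p_\delta(a)=\prod_{i=1}^m p_{\sum_{j\in\delta_i}a_j}$ and $\frac{\partial}{\partial\hat p_\delta}(a)=\prod_{i=1}^m\big((\sum_{j\in\delta_i}a_j)\,\partial/\partial p_{\sum_{j\in\delta_i}a_j}\big)$. Permutations compose as functions, $(\sigma\tau)(x)=\sigma(\tau(x))$. With $\phi_d(\delta)=(d\ d{-}1\ \cdots\ 1)\delta$, define \[ \Delta_d=\frac1d\sum_{\delta\in S_d}\sum_{a_1,\dots,a_d\ge1}\hat p_{\phi_d(\delta)}(a_1,\dots,a_d)\frac{\partial}{\partial\hat p_\delta}(a_1,\dots,a_d). \] *)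

theory Defs
  imports
    Complex_Main
    "HOL-Library.Poly_Mapping"
    "HOL-Library.FuncSet"
    "HOL-Combinatorics.Cycles"
    "HOL-Combinatorics.Orbits"
begin

section \<open>Formal power series in arbitrarily many commuting indeterminates\<close>

text \<open>
  A monomial is a finitely supported exponent function; a power series is an arbitrary family of
  coefficients indexed by monomials.
\<close>

typedef ('v, 'a) mps = "UNIV :: (('v \<Rightarrow>\<^sub>0 nat) \<Rightarrow> 'a) set"
  morphisms mps_coeff Abs_mps ..

setup_lifting type_definition_mps

lemma mps_coeff_Abs [simp]: "mps_coeff (Abs_mps f) = f"
  by (simp add: Abs_mps_inverse)

lemma mps_eqI: "(\<And>m. mps_coeff f m = mps_coeff g m) \<Longrightarrow> f = g"
  by (simp add: mps_coeff_inject [symmetric] fun_eq_iff)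

definition splits :: "('v \<Rightarrow>\<^sub>0 nat) \<Rightarrow> (('v \<Rightarrow>\<^sub>0 nat) \<times> ('v \<Rightarrow>\<^sub>0 nat)) set"
  where "splits m = {(m1, m2). m1 + m2 = m}"

lemma finite_splits [simp]: "finite (splits m)"
proof -
  let ?B = "Poly_Mapping.keys m \<rightarrow>\<^sub>E {..Max (insert 0 (Poly_Mapping.lookup m ` Poly_Mapping.keys m))}"
  let ?g = "\<lambda>p. restrict (Poly_Mapping.lookup (fst p)) (Poly_Mapping.keys m)"
  have le: "Poly_Mapping.lookup m1 x \<le> Poly_Mapping.lookup m x" if "(m1, m2) \<in> splits m" for m1 m2 x
    using that by (auto simp: splits_def lookup_add)
  have img: "?g ` splits m \<subseteq> ?B"
  proof
    fix h assume "h \<in> ?g ` splits m"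
    then obtain m1 m2 where h: "h = restrict (Poly_Mapping.lookup m1) (Poly_Mapping.keys m)" "(m1, m2) \<in> splits m"
      by auto
    have "Poly_Mapping.lookup m1 x \<le> Max (insert 0 (Poly_Mapping.lookup m ` Poly_Mapping.keys m))"
      if "x \<in> Poly_Mapping.keys m" for x
      by (rule order_trans [OF le [OF h(2), of x]], rule Max_ge) (use that in auto)
    then show "h \<in> ?B" by (auto simp: h(1))
  qed
  have "inj_on ?g (splits m)"
  proof (rule inj_onI, clarsimp)
    fix m1 m2 n1 n2
    assume a: "(m1, m2) \<in> splits m" "(n1, n2) \<in> splits m"
      and eq: "restrict (Poly_Mapping.lookup m1) (Poly_Mapping.keys m) = restrict (Poly_Mapping.lookup n1) (Poly_Mapping.keys m)"
    have "Poly_Mapping.lookup m1 x = Poly_Mapping.lookup n1 x" for x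
    proof (cases "x \<in> Poly_Mapping.keys m")
      case True
      then show ?thesis using fun_cong [OF eq, of x] by simp
    next
      case False
      then have "Poly_Mapping.lookup m x = 0" by (simp add: in_keys_iff)
      then show ?thesis using le [OF a(1), of x] le [OF a(2), of x] by simp
    qed
    then have "m1 = n1" by (rule poly_mapping_eqI)
    moreover have "m1 + m2 = n1 + n2" using a by (simp add: splits_def)
    ultimately show "m1 = n1 \<and> m2 = n2" by simp
  qed
  moreover have "finite ?B" by (intro finite_PiE) auto
  ultimately show ?thesis using img by (meson finite_imageD finite_subset)
qed

instantiation mps :: (type, comm_ring_1) comm_ring_1
begin

lift_definition zero_mps :: "('a, 'b) mps" is "\<lambda>_. 0" .
lift_definition one_mps :: "('a, 'b) mps" is "\<lambda>m. if m = 0 then 1 else 0" .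
lift_definition plus_mps :: "('a, 'b) mps \<Rightarrow> ('a, 'b) mps \<Rightarrow> ('a, 'b) mps"
  is "\<lambda>f g m. f m + g m" .
lift_definition minus_mps :: "('a, 'b) mps \<Rightarrow> ('a, 'b) mps \<Rightarrow> ('a, 'b) mps"
  is "\<lambda>f g m. f m - g m" .
lift_definition uminus_mps :: "('a, 'b) mps \<Rightarrow> ('a, 'b) mps"
  is "\<lambda>f m. - f m" .
lift_definition times_mps :: "('a, 'b) mps \<Rightarrow> ('a, 'b) mps \<Rightarrow> ('a, 'b) mps"
  is "\<lambda>f g m. \<Sum>(m1, m2)\<in>splits m. f m1 * g m2" .

instance
proof
  fix f g h :: "('a, 'b) mps"
  show "f * g * h = f * (g * h)"
  proof transfer
    fix f g h :: "('a \<Rightarrow>\<^sub>0 nat) \<Rightarrow> 'b"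
    show "(\<lambda>m. \<Sum>(m1, m2)\<in>splits m. (\<Sum>(m1, m2)\<in>splits m1. f m1 * g m2) * h m2) =
          (\<lambda>m. \<Sum>(m1, m2)\<in>splits m. f m1 * (\<Sum>(m1, m2)\<in>splits m2. g m1 * h m2))"
    proof
      fix m
      have "(\<Sum>(m1, m2)\<in>splits m. (\<Sum>(m1, m2)\<in>splits m1. f m1 * g m2) * h m2) =
            (\<Sum>p\<in>splits m. \<Sum>q\<in>splits (fst p). f (fst q) * g (snd q) * h (snd p))"
        by (simp add: case_prod_unfold sum_distrib_right)
      also have "\<dots> = (\<Sum>(p, q)\<in>Sigma (splits m) (\<lambda>p. splits (fst p)).
                          f (fst q) * g (snd q) * h (snd p))"
        by (rule sum.Sigma) auto
      also have "\<dots> = (\<Sum>(p, q)\<in>Sigma (splits m) (\<lambda>p. splits (snd p)).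
                          f (fst p) * (g (fst q) * h (snd q)))"
        by (rule sum.reindex_bij_witness
              [where i = "\<lambda>(p, q). ((fst p + fst q, snd q), (fst p, fst q))"
                 and j = "\<lambda>(p, q). ((fst q, snd q + snd p), (snd q, snd p))"])
           (auto simp: splits_def mult.assoc add.assoc)
      also have "\<dots> = (\<Sum>p\<in>splits m. \<Sum>q\<in>splits (snd p). f (fst p) * (g (fst q) * h (snd q)))"
        by (rule sum.Sigma [symmetric]) auto
      also have "\<dots> = (\<Sum>(m1, m2)\<in>splits m. f m1 * (\<Sum>(m1, m2)\<in>splits m2. g m1 * h m2))"
        by (simp add: case_prod_unfold sum_distrib_left)
      finally show "(\<Sum>(m1, m2)\<in>splits m. (\<Sum>(m1, m2)\<in>splits m1. f m1 * g m2) * h m2) =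
            (\<Sum>(m1, m2)\<in>splits m. f m1 * (\<Sum>(m1, m2)\<in>splits m2. g m1 * h m2))" .
    qed
  qed
  show "f * g = g * f"
  proof transfer
    fix f g :: "('a \<Rightarrow>\<^sub>0 nat) \<Rightarrow> 'b"
    show "(\<lambda>m. \<Sum>(m1, m2)\<in>splits m. f m1 * g m2) = (\<lambda>m. \<Sum>(m1, m2)\<in>splits m. g m1 * f m2)"
    proof
      fix m
      show "(\<Sum>(m1, m2)\<in>splits m. f m1 * g m2) = (\<Sum>(m1, m2)\<in>splits m. g m1 * f m2)"
        by (rule sum.reindex_bij_witness
              [where i = "\<lambda>(x, y). (y, x)" and j = "\<lambda>(x, y). (y, x)"])
           (auto simp: splits_def add.commute mult.commute)
    qed
  qed
  show "1 * f = f"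
  proof transfer
    fix f :: "('a \<Rightarrow>\<^sub>0 nat) \<Rightarrow> 'b"
    show "(\<lambda>m. \<Sum>(m1, m2)\<in>splits m. (if m1 = 0 then 1 else 0) * f m2) = f"
    proof
      fix m
      have "(\<Sum>(m1, m2)\<in>splits m. (if m1 = 0 then 1 else 0) * f m2) =
            (\<Sum>(m1, m2)\<in>{(0 :: 'a \<Rightarrow>\<^sub>0 nat, m)}. (if m1 = 0 then 1 else 0) * f m2)"
        by (intro sum.mono_neutral_right finite_splits) (auto simp: splits_def split: if_splits)
      then show "(\<Sum>(m1, m2)\<in>splits m. (if m1 = 0 then 1 else 0) * f m2) = f m"
        by simp
    qed
  qed
  show "(f + g) * h = f * h + g * h"
    by transfer (simp add: fun_eq_iff case_prod_unfold distrib_right sum.distrib)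
  show "f + g + h = f + (g + h)" by transfer (simp add: add.assoc)
  show "f + g = g + f" by transfer (simp add: add.commute)
  show "0 + f = f" by transfer simp
  show "- f + f = 0" by transfer simp
  show "f - g = f + - g" by transfer simp
  show "(0 :: ('a, 'b) mps) \<noteq> 1" by transfer (auto simp: fun_eq_iff)
qed

end

lemma mps_coeff_mult:
  "mps_coeff (f * g) m = (\<Sum>(m1, m2)\<in>splits m. mps_coeff f m1 * mps_coeff g m2)"
  by transfer simp

definition mps_const :: "'a::zero \<Rightarrow> ('v, 'a) mps"
  where "mps_const c = Abs_mps (\<lambda>m. if m = 0 then c else 0)"

definition mps_var :: "'v \<Rightarrow> ('v, 'a::zero_neq_one) mps"
  where "mps_var v = Abs_mps (\<lambda>m. if m = Poly_Mapping.single v 1 then 1 else 0)"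

definition mps_deriv :: "'v \<Rightarrow> ('v, 'a::semiring_1) mps \<Rightarrow> ('v, 'a) mps"
  where "mps_deriv v f =
    Abs_mps (\<lambda>m. of_nat (Poly_Mapping.lookup m v + 1) * mps_coeff f (m + Poly_Mapping.single v 1))"

text \<open>
  Infinite sums of series are taken coefficientwise.  They are meaningful only when every monomial
  occurs in finitely many of the summands; the value of \<^const>\<open>sum'\<close> is \<open>0\<close> otherwise.
\<close>

definition mps_sum :: "('i \<Rightarrow> ('v, 'a::comm_monoid_add) mps) \<Rightarrow> 'i set \<Rightarrow> ('v, 'a) mps"
  where "mps_sum f A = Abs_mps (\<lambda>m. sum' (\<lambda>i. mps_coeff (f i) m) A)"

definition mps_summable :: "('i \<Rightarrow> ('v, 'a::zero) mps) \<Rightarrow> 'i set \<Rightarrow> bool"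
  where "mps_summable f A \<longleftrightarrow> (\<forall>m. finite {i \<in> A. mps_coeff (f i) m \<noteq> 0})"

lemma mps_deriv_commute: "mps_deriv v (mps_deriv w f) = mps_deriv w (mps_deriv v f)"
  for f :: "('v, 'a::comm_semiring_1) mps"
proof (rule mps_eqI, cases "v = w")
  case False
  fix m
  show "mps_coeff (mps_deriv v (mps_deriv w f)) m = mps_coeff (mps_deriv w (mps_deriv v f)) m"
    using False by (simp add: mps_deriv_def lookup_add lookup_single ac_simps)
qed simp

lemma mps_coeff_var_mult_nonzero:
  assumes "mps_coeff (mps_var v * g) m \<noteq> 0"
  shows "v \<in> Poly_Mapping.keys m"
proof -
  obtain q where q: "q \<in> splits m"
      "(case q of (m1, m2) \<Rightarrow> mps_coeff (mps_var v) m1 * mps_coeff g m2) \<noteq> 0"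
    using sum.not_neutral_contains_not_neutral [OF assms [unfolded mps_coeff_mult]] .
  obtain m1 m2 where "q = (m1, m2)" by (cases q)
  with q have *: "(m1, m2) \<in> splits m" "mps_coeff (mps_var v) m1 * mps_coeff g m2 \<noteq> 0"
    by simp_all
  then have "m1 = Poly_Mapping.single v 1" by (auto simp: mps_var_def split: if_splits)
  then have "Poly_Mapping.lookup m v \<noteq> 0" using * by (auto simp: splits_def lookup_add)
  then show ?thesis by (simp add: in_keys_iff)
qed


section \<open>The matrix of indeterminates and the operator \<open>W([d])\<close>\<close>

type_synonym xseries = "(nat \<times> nat, complex) mps"

definition Xvar :: "nat \<Rightarrow> nat \<Rightarrow> xseries"
  where "Xvar a b = mps_var (a, b)"

primrec X_power :: "nat \<Rightarrow> nat \<Rightarrow> nat \<Rightarrow> xseries"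
  where
    "X_power 0 a b = (if a = b then 1 else 0)"
  | "X_power (Suc k) a b = mps_sum (\<lambda>c. X_power k a c * Xvar c b) {1..}"

definition power_sum :: "nat \<Rightarrow> xseries"
  where "power_sum k = mps_sum (\<lambda>a. X_power k a a) {1..}"

lemma X_power_summable: "mps_summable (\<lambda>c. X_power k a c * Xvar c b) A"
  unfolding mps_summable_def
proof
  fix m
  have "(c, b) \<in> Poly_Mapping.keys m" if "mps_coeff (X_power k a c * Xvar c b) m \<noteq> 0" for c
    by (rule mps_coeff_var_mult_nonzero [of _ "X_power k a c"])
       (use that in \<open>simp add: Xvar_def mult.commute\<close>)
  then have "{c \<in> A. mps_coeff (X_power k a c * Xvar c b) m \<noteq> 0} \<subseteq> fst ` Poly_Mapping.keys m"
    by force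
  then show "finite {c \<in> A. mps_coeff (X_power k a c * Xvar c b) m \<noteq> 0}"
    by (rule finite_subset) simp
qed

lemma power_sum_summable:
  assumes "k \<ge> 1"
  shows "mps_summable (\<lambda>a. X_power k a a) A"
  unfolding mps_summable_def
proof
  fix m
  obtain l where k: "k = Suc l" using assms by (cases k) auto
  have "a \<in> snd ` Poly_Mapping.keys m" if nz: "mps_coeff (X_power k a a) m \<noteq> 0" for a
  proof -
    obtain c where c: "mps_coeff (X_power l a c * Xvar c a) m \<noteq> 0"
      using nz unfolding k X_power.simps mps_sum_def mps_coeff_Abs sum.G_def
      by (metis (mono_tags, lifting) sum.neutral)
    have "(c, a) \<in> Poly_Mapping.keys m"
      by (rule mps_coeff_var_mult_nonzero [of _ "X_power l a c"])
         (use c in \<open>simp add: Xvar_def mult.commute\<close>)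
    then show ?thesis by force
  qed
  then have "{a \<in> A. mps_coeff (X_power k a a) m \<noteq> 0} \<subseteq> snd ` Poly_Mapping.keys m"
    by blast
  then show "finite {a \<in> A. mps_coeff (X_power k a a) m \<noteq> 0}"
    by (rule finite_subset) simp
qed

text \<open>
  The product of the derivations is a composition of commuting operators, hence a fold over the
  index set.  The update \<open>a(Suc d := a 1)\<close> is the convention \<open>a\<^sub>d\<^sub>+\<^sub>1 = a\<^sub>1\<close>.
\<close>

definition W_deriv :: "nat \<Rightarrow> (nat \<Rightarrow> nat) \<Rightarrow> (nat \<Rightarrow> nat) \<Rightarrow> xseries \<Rightarrow> xseries"
  where "W_deriv d a e f =
    Finite_Set.fold (\<lambda>i. mps_deriv ((a(Suc d := a 1)) (Suc i), e i)) f {1..d}"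

definition W :: "nat \<Rightarrow> xseries \<Rightarrow> xseries"
  where "W d f = mps_const (1 / of_nat d) *
    mps_sum (\<lambda>(a, e). (\<Prod>i=1..d. Xvar (a i) (e i)) * W_deriv d a e f)
      (({1..d} \<rightarrow>\<^sub>E {1..}) \<times> ({1..d} \<rightarrow>\<^sub>E {1..}))"

lemma W_deriv_comp_fun_commute: "comp_fun_commute (\<lambda>i. mps_deriv (v i) :: xseries \<Rightarrow> xseries)"
  by unfold_locales (auto simp: fun_eq_iff mps_deriv_commute)

lemma W_summable:
  "mps_summable (\<lambda>(a, e). (\<Prod>i=1..d. Xvar (a i) (e i)) * W_deriv d a e f)
     (({1..d} \<rightarrow>\<^sub>E {1..}) \<times> ({1..d} \<rightarrow>\<^sub>E {1..}))"
  unfolding mps_summable_def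
proof
  fix m
  let ?S = "{p \<in> ({1..d} \<rightarrow>\<^sub>E {1..}) \<times> ({1..d} \<rightarrow>\<^sub>E {1..}).
    mps_coeff (case p of (a, e) \<Rightarrow> (\<Prod>i=1..d. Xvar (a i) (e i)) * W_deriv d a e f) m \<noteq> 0}"
  have key: "(a i, e i) \<in> Poly_Mapping.keys m"
    if "mps_coeff ((\<Prod>i=1..d. Xvar (a i) (e i)) * W_deriv d a e f) m \<noteq> 0" "i \<in> {1..d}" for a e i
  proof -
    have "(\<Prod>i=1..d. Xvar (a i) (e i)) * W_deriv d a e f =
        mps_var (a i, e i) * ((\<Prod>i\<in>{1..d} - {i}. Xvar (a i) (e i)) * W_deriv d a e f)"
      unfolding prod.remove [OF finite_atLeastAtMost that(2)] by (simp only: Xvar_def mult.assoc)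
    then show ?thesis using that(1) by (intro mps_coeff_var_mult_nonzero) simp
  qed
  have "?S \<subseteq> ({1..d} \<rightarrow>\<^sub>E fst ` Poly_Mapping.keys m) \<times> ({1..d} \<rightarrow>\<^sub>E snd ` Poly_Mapping.keys m)"
  proof
    fix p assume p: "p \<in> ?S"
    obtain a e where pe: "p = (a, e)" by (cases p)
    have "a \<in> extensional {1..d}" "e \<in> extensional {1..d}"
      using p by (auto simp: pe PiE_def)
    moreover have "(a i, e i) \<in> Poly_Mapping.keys m" if "i \<in> {1..d}" for i
      using key [OF _ that] p by (auto simp: pe)
    then have "a i \<in> fst ` Poly_Mapping.keys m" "e i \<in> snd ` Poly_Mapping.keys m"
      if "i \<in> {1..d}" for i
      using that by force+
    ultimately show "p \<in> ({1..d} \<rightarrow>\<^sub>E fst ` Poly_Mapping.keys m) \<times> ({1..d} \<rightarrow>\<^sub>E snd ` Poly_Mapping.keys m)"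
      by (simp add: pe PiE_def Pi_def)
  qed
  then show "finite ?S"
    by (rule finite_subset) (intro finite_cartesian_product finite_PiE finite_imageI; simp)
qed


section \<open>The polynomial ring in the power sums and the operator \<open>\<Delta>\<^sub>d\<close>\<close>

text \<open>
  The polynomial ring has an indeterminate for each natural number; the polynomials in
  \<open>p\<^sub>1, p\<^sub>2, \<dots>\<close> are those not involving the one with index \<open>0\<close>.
\<close>

type_synonym ppoly = "(nat \<Rightarrow>\<^sub>0 nat) \<Rightarrow>\<^sub>0 complex"

definition pvars :: "ppoly \<Rightarrow> nat set"
  where "pvars P = (\<Union>m\<in>Poly_Mapping.keys P. Poly_Mapping.keys m)"

definition p_ring :: "ppoly set"
  where "p_ring = {P. 0 \<notin> pvars P}"

definition pvar :: "nat \<Rightarrow> ppoly"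
  where "pvar k = Poly_Mapping.single (Poly_Mapping.single k 1) 1"

lift_definition deriv_p :: "nat \<Rightarrow> ppoly \<Rightarrow> ppoly"
  is "\<lambda>k P m. of_nat (Poly_Mapping.lookup m k + 1) * P (m + Poly_Mapping.single k 1)"
proof -
  fix k :: nat and P :: "(nat \<Rightarrow>\<^sub>0 nat) \<Rightarrow> complex"
  assume "finite {m. P m \<noteq> 0}"
  then have "finite ((\<lambda>m. m + Poly_Mapping.single k 1) -` {m. P m \<noteq> 0})"
    by (rule finite_vimageI) (simp add: inj_def)
  then show "finite {m. of_nat (Poly_Mapping.lookup m k + 1) * P (m + Poly_Mapping.single k 1) \<noteq> 0}"
    by (rule rev_finite_subset) auto
qed

text \<open>The embedding of the polynomial ring into the power series, \<open>p\<^sub>k \<mapsto> tr (X\<^sup>k)\<close>.\<close>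

definition to_xseries :: "ppoly \<Rightarrow> xseries"
  where "to_xseries P =
    (\<Sum>m\<in>Poly_Mapping.keys P. mps_const (Poly_Mapping.lookup P m) *
      (\<Prod>k\<in>Poly_Mapping.keys m. power_sum k ^ Poly_Mapping.lookup m k))"

definition cycles :: "nat \<Rightarrow> (nat \<Rightarrow> nat) \<Rightarrow> nat set set"
  where "cycles d \<delta> = orbit \<delta> ` {1..d}"

definition p_hat :: "nat \<Rightarrow> (nat \<Rightarrow> nat) \<Rightarrow> (nat \<Rightarrow> nat) \<Rightarrow> ppoly"
  where "p_hat d \<delta> a = (\<Prod>c\<in>cycles d \<delta>. pvar (\<Sum>j\<in>c. a j))"

definition deriv_p_hat :: "nat \<Rightarrow> (nat \<Rightarrow> nat) \<Rightarrow> (nat \<Rightarrow> nat) \<Rightarrow> ppoly \<Rightarrow> ppoly"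
  where "deriv_p_hat d \<delta> a P =
    Finite_Set.fold (\<lambda>c Q. of_nat (\<Sum>j\<in>c. a j) * deriv_p (\<Sum>j\<in>c. a j) Q) P (cycles d \<delta>)"

definition phi :: "nat \<Rightarrow> (nat \<Rightarrow> nat) \<Rightarrow> (nat \<Rightarrow> nat)"
  where "phi d \<delta> = cycle_of_list (rev [1..<Suc d]) \<circ> \<delta>"

definition Delta :: "nat \<Rightarrow> ppoly \<Rightarrow> ppoly"
  where "Delta d P = Poly_Mapping.single 0 (1 / of_nat d) *
    (\<Sum>\<delta> | \<delta> permutes {1..d}.
       sum' (\<lambda>a. p_hat d (phi d \<delta>) a * deriv_p_hat d \<delta> a P) ({1..d} \<rightarrow>\<^sub>E {1..}))"

lemma to_xseries_pvar: "to_xseries (pvar k) = power_sum k"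
proof -
  have "mps_const 1 = (1 :: xseries)"
    by (rule mps_eqI) (simp add: mps_const_def one_mps.rep_eq)
  then show ?thesis by (simp add: to_xseries_def pvar_def)
qed

lemma long_cycle_apply:
  assumes "i \<in> {1..d}"
  shows "cycle_of_list (rev [1..<Suc d]) i = (if i = 1 then d else i - 1)"
  using assms
proof (induction d arbitrary: i)
  case (Suc d)
  show ?case
  proof (cases d)
    case 0
    then show ?thesis using Suc.prems by auto
  next
    case (Suc d')
    have "cycle_of_list (rev [1..<Suc (Suc d)]) =
        transpose (Suc d) d \<circ> cycle_of_list (rev [1..<Suc d])"
      by (simp add: Suc)
    moreover have "cycle_of_list (rev [1..<Suc d]) (Suc d) = Suc d"
      by (rule id_outside_supp) simp
    ultimately show ?thesis
      using Suc.prems Suc.IH [of i] Suc by (cases "i = Suc d") (auto simp: transpose_def)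
  qed
qed simp

lemma deriv_p_commute: "deriv_p k (deriv_p l P) = deriv_p l (deriv_p k P)"
  by (cases "k = l")
     (auto intro!: poly_mapping_eqI simp: deriv_p.rep_eq lookup_add lookup_single ac_simps)

lemma lookup_of_nat_mult: "Poly_Mapping.lookup (of_nat n * P) m = of_nat n * Poly_Mapping.lookup P m" for P :: ppoly
  by (induction n) (simp_all add: distrib_right lookup_add)

lemma deriv_p_of_nat_mult: "deriv_p k (of_nat n * P) = of_nat n * deriv_p k P"
  by (rule poly_mapping_eqI) (simp add: deriv_p.rep_eq lookup_of_nat_mult mult.left_commute)

lemma deriv_p_hat_comp_fun_commute:
  "comp_fun_commute (\<lambda>c Q. of_nat (\<Sum>j\<in>c. a j) * deriv_p (\<Sum>j\<in>c. a j) Q)"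
proof -
  have "of_nat k * deriv_p k (of_nat l * deriv_p l Q) = of_nat l * deriv_p l (of_nat k * deriv_p k Q)"
    for k l Q
    by (simp add: deriv_p_of_nat_mult deriv_p_commute [of k] mult.left_commute)
  then show ?thesis
    by unfold_locales (simp add: fun_eq_iff del: of_nat_sum)
qed

lemma pvars_deriv_p: "pvars (deriv_p k P) \<subseteq> pvars P"
proof
  fix x assume "x \<in> pvars (deriv_p k P)"
  then obtain m where m: "m \<in> Poly_Mapping.keys (deriv_p k P)" "x \<in> Poly_Mapping.keys m" by (auto simp: pvars_def)
  then have "m + Poly_Mapping.single k 1 \<in> Poly_Mapping.keys P" by (auto simp: in_keys_iff deriv_p.rep_eq)
  moreover have "x \<in> Poly_Mapping.keys (m + Poly_Mapping.single k 1)"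
    using m(2) by (auto simp: in_keys_iff lookup_add)
  ultimately show "x \<in> pvars P" by (auto simp: pvars_def)
qed

lemma pvars_of_nat_mult: "pvars (of_nat n * P) \<subseteq> pvars P"
  by (auto simp: pvars_def in_keys_iff lookup_of_nat_mult)

lemma deriv_p_eq_0: "deriv_p k P = 0" if "k \<notin> pvars P"
proof (rule poly_mapping_eqI)
  fix m :: "nat \<Rightarrow>\<^sub>0 nat"
  have "k \<in> Poly_Mapping.keys (m + Poly_Mapping.single k 1)"
    unfolding in_keys_iff lookup_add by simp
  then have "m + Poly_Mapping.single k 1 \<notin> Poly_Mapping.keys P" using that by (auto simp: pvars_def)
  then show "Poly_Mapping.lookup (deriv_p k P) m = Poly_Mapping.lookup 0 m" by (simp add: deriv_p.rep_eq in_keys_iff)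
qed

lemma finite_cycles [simp]: "finite (cycles d \<delta>)"
  by (simp add: cycles_def)

lemma deriv_p_hat_pvars:
  "pvars (deriv_p_hat d \<delta> a P) \<subseteq> pvars P \<and>
   (deriv_p_hat d \<delta> a P \<noteq> 0 \<longrightarrow> (\<forall>c\<in>cycles d \<delta>. (\<Sum>j\<in>c. a j) \<in> pvars P))"
proof -
  interpret comp_fun_commute "\<lambda>c Q. of_nat (\<Sum>j\<in>c. a j) * deriv_p (\<Sum>j\<in>c. a j) Q"
    by (rule deriv_p_hat_comp_fun_commute)
  let ?F = "Finite_Set.fold (\<lambda>c Q. of_nat (\<Sum>j\<in>c. a j) * deriv_p (\<Sum>j\<in>c. a j) Q) P"
  have "pvars (?F C) \<subseteq> pvars P \<and> (?F C \<noteq> 0 \<longrightarrow> (\<forall>c\<in>C. (\<Sum>j\<in>c. a j) \<in> pvars P))"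
    if "finite C" for C
    using that
  proof induction
    case (insert c C)
    let ?n = "\<Sum>j\<in>c. a j"
    have eq: "?F (insert c C) = of_nat ?n * deriv_p ?n (?F C)"
      by (rule fold_insert [OF insert.hyps])
    have sub: "pvars (?F (insert c C)) \<subseteq> pvars (?F C)"
      unfolding eq using pvars_of_nat_mult pvars_deriv_p by blast
    have nz: "?F C \<noteq> 0 \<and> ?n \<in> pvars (?F C)" if "?F (insert c C) \<noteq> 0"
    proof -
      have "deriv_p ?n (?F C) \<noteq> 0" using that unfolding eq by auto
      then have "?n \<in> pvars (?F C)" using deriv_p_eq_0 by blast
      then show ?thesis by (auto simp: pvars_def)
    qed
    show ?case using sub nz insert.IH by blast
  qed simp
  then show ?thesis unfolding deriv_p_hat_def using finite_cycles by blast
qed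

lemma p_ring_0: "0 \<in> p_ring"
  by (simp add: p_ring_def pvars_def)

lemma p_ring_single_0: "Poly_Mapping.single 0 c \<in> p_ring"
  by (simp add: p_ring_def pvars_def)

lemma p_ring_1: "1 \<in> p_ring"
  by (simp add: p_ring_def pvars_def)

lemma p_ring_add: "P \<in> p_ring \<Longrightarrow> Q \<in> p_ring \<Longrightarrow> P + Q \<in> p_ring"
  using Poly_Mapping.keys_add [of P Q] by (auto simp: p_ring_def pvars_def)

lemma p_ring_mult:
  assumes "P \<in> p_ring" "Q \<in> p_ring"
  shows "P * Q \<in> p_ring"
proof -
  have "0 \<notin> Poly_Mapping.keys m" if m: "m \<in> Poly_Mapping.keys (P * Q)" for m
  proof -
    obtain m1 m2 where "m = m1 + m2" "m1 \<in> Poly_Mapping.keys P" "m2 \<in> Poly_Mapping.keys Q"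
      using m keys_mult [of P Q] by blast
    then show ?thesis
      using assms by (auto simp: p_ring_def pvars_def in_keys_iff lookup_add)
  qed
  then show ?thesis by (auto simp: p_ring_def pvars_def)
qed

lemma p_ring_sum: "(\<And>x. x \<in> A \<Longrightarrow> f x \<in> p_ring) \<Longrightarrow> sum f A \<in> p_ring"
  by (induction A rule: infinite_finite_induct) (simp_all add: p_ring_0 p_ring_add)

lemma p_ring_prod: "(\<And>x. x \<in> A \<Longrightarrow> f x \<in> p_ring) \<Longrightarrow> prod f A \<in> p_ring"
  by (induction A rule: infinite_finite_induct) (simp_all add: p_ring_1 p_ring_mult)

lemma p_ring_pvar: "k \<ge> 1 \<Longrightarrow> pvar k \<in> p_ring"
  by (simp add: p_ring_def pvars_def pvar_def)

lemma cycles_permutes: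
  fixes d :: nat
  assumes "\<delta> permutes {1..d}" "i \<in> {1..d}"
  shows "i \<in> orbit \<delta> i" and "orbit \<delta> i \<subseteq> {1..d}"
proof -
  show "i \<in> orbit \<delta> i"
    by (rule permutation_self_in_orbit [OF permutes_imp_permutation [OF _ assms(1)]]) simp
  show "orbit \<delta> i \<subseteq> {1..d}"
    using assms by (simp add: permutes_orbit_subset)
qed

lemma Delta_finite_support:
  assumes "\<delta> permutes {1..d}"
  shows "finite {a \<in> {1..d} \<rightarrow>\<^sub>E {1..}. p_hat d (phi d \<delta>) a * deriv_p_hat d \<delta> a P \<noteq> 0}"
proof -
  have fin: "finite (pvars P)" by (simp add: pvars_def)
  have "{a \<in> {1..d} \<rightarrow>\<^sub>E {1..}. p_hat d (phi d \<delta>) a * deriv_p_hat d \<delta> a P \<noteq> 0} \<subseteq>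
        {1..d} \<rightarrow>\<^sub>E {..Max (pvars P)}"
  proof
    fix a
    assume a: "a \<in> {a \<in> {1..d} \<rightarrow>\<^sub>E {1..}. p_hat d (phi d \<delta>) a * deriv_p_hat d \<delta> a P \<noteq> 0}"
    then have nz: "deriv_p_hat d \<delta> a P \<noteq> 0" by auto
    have "a i \<le> Max (pvars P)" if i: "i \<in> {1..d}" for i
    proof -
      have "a i \<le> (\<Sum>j\<in>orbit \<delta> i. a j)"
        by (rule member_le_sum [OF cycles_permutes(1) [OF assms i]])
           (use finite_subset [OF cycles_permutes(2) [OF assms i]] in auto)
      also have "\<dots> \<le> Max (pvars P)"
        by (rule Max_ge [OF fin])
           (use deriv_p_hat_pvars [of d \<delta> a P] nz i in \<open>simp add: cycles_def\<close>)
      finally show ?thesis .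
    qed
    then show "a \<in> {1..d} \<rightarrow>\<^sub>E {..Max (pvars P)}"
      using a by (auto simp: PiE_def)
  qed
  then show ?thesis by (rule finite_subset) (simp add: finite_PiE)
qed

lemma phi_permutes:
  assumes "\<delta> permutes {1..d}"
  shows "phi d \<delta> permutes {1..d}"
proof -
  have "cycle_of_list (rev [1..<Suc d]) permutes set (rev [1..<Suc d])"
    by (rule cycle_permutes)
  moreover have "set (rev [1..<Suc d]) = {1..d}" by auto
  ultimately show ?thesis
    unfolding phi_def using assms by (metis permutes_compose)
qed

lemma Delta_in_p_ring:
  assumes "P \<in> p_ring"
  shows "Delta d P \<in> p_ring"
proof -
  have "p_hat d (phi d \<delta>) a * deriv_p_hat d \<delta> a P \<in> p_ring"
    if \<delta>: "\<delta> permutes {1..d}" and a: "a \<in> {1..d} \<rightarrow>\<^sub>E {1..}" for \<delta> a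
  proof (rule p_ring_mult)
    show "deriv_p_hat d \<delta> a P \<in> p_ring"
      using deriv_p_hat_pvars [of d \<delta> a P] assms by (auto simp: p_ring_def)
    show "p_hat d (phi d \<delta>) a \<in> p_ring"
      unfolding p_hat_def
    proof (intro p_ring_prod p_ring_pvar)
      fix c assume "c \<in> cycles d (phi d \<delta>)"
      then obtain i where i: "i \<in> {1..d}" "c = orbit (phi d \<delta>) i" by (auto simp: cycles_def)
      note c = cycles_permutes [OF phi_permutes [OF \<delta>] i(1), folded i(2)]
      have "1 \<le> a i" using a i(1) by auto
      also have "a i \<le> (\<Sum>j\<in>c. a j)"
        by (rule member_le_sum [OF c(1)]) (use finite_subset [OF c(2)] in auto)
      finally show "1 \<le> (\<Sum>j\<in>c. a j)" .
    qed
  qed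
  then have "sum' (\<lambda>a. p_hat d (phi d \<delta>) a * deriv_p_hat d \<delta> a P) ({1..d} \<rightarrow>\<^sub>E {1..}) \<in> p_ring"
    if "\<delta> permutes {1..d}" for \<delta>
    using that unfolding sum.G_def by (auto simp del: mult_eq_0_iff intro!: p_ring_0 p_ring_sum)
  then show ?thesis
    unfolding Delta_def by (intro p_ring_mult p_ring_single_0 p_ring_sum) simp
qed

end

theory Submission
  imports Defs
begin

text \<open>
  Each coefficient of a series in the \<open>X\<^sub>a\<^sub>b\<close> involves finitely many indices, so setting
  \<open>X\<^sub>a\<^sub>b = 0\<close> for large indices reduces the claim to a finite matrix \<open>X\<close>, where all index sums are
  finite.  There \<open>\<partial>p\<^sub>k/\<partial>X\<^sub>x\<^sub>y = k (X\<^sup>k\<^sup>-\<^sup>1)\<^sub>y\<^sub>x\<close>, and differentiating a matrix power cuts it in two.  Hence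
  applying derivations \<open>\<partial>/\<partial>X\<^bsub>x(i) y(i)\<^esub>\<close> for \<open>i = 1, \<dots>, n\<close> to a polynomial in the \<open>p\<^sub>k\<close> gives
  \[\sum_{\delta, k} \prod_i (X^{k_i-1})_{y(\delta i)\, x(i)} \cdot \partial/\partial\hat p_\delta(k),\]
  by induction on \<open>n\<close>: the new derivation either hits the polynomial, making \<open>n + 1\<close> a fixed point
  of \<open>\<delta>\<close>, or cuts the \<open>i\<close>-th power, replacing \<open>\<delta>\<close> by \<open>\<delta> \<circ> (i n+1)\<close>, which inserts \<open>n + 1\<close> into
  the cycle of \<open>i\<close> and preserves the cycle sums of \<open>k\<close>.  For \<open>x(i) = a\<^sub>i\<^sub>+\<^sub>1\<close>, \<open>y(i) = e\<^sub>i\<close>, multiplying by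
  \<open>X\<^bsub>a(i) e(i)\<^esub>\<close> and summing over \<open>a\<close> and \<open>e\<close> closes the matrix powers up into one trace for each
  cycle of \<open>\<phi>\<^sub>d(\<delta>)\<close>.
\<close>

section \<open>Derivations of power series\<close>

lemma mps_coeff_add [simp]: "mps_coeff (f + g) m = mps_coeff f m + mps_coeff g m"
  by transfer simp

lemma mps_coeff_0 [simp]: "mps_coeff 0 m = 0"
  by transfer simp

lemma mps_coeff_1: "mps_coeff 1 m = (if m = 0 then 1 else 0)"
  by transfer simp

lemma mps_coeff_sum: "mps_coeff (sum f A) m = (\<Sum>i\<in>A. mps_coeff (f i) m)"
  by (induction A rule: infinite_finite_induct) auto

lemma mps_coeff_deriv:
  "mps_coeff (mps_deriv v f) m =
    of_nat (Poly_Mapping.lookup m v + 1) * mps_coeff f (m + Poly_Mapping.single v 1)"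
  by (simp add: mps_deriv_def)

lemma mps_coeff_const_mult:
  "mps_coeff (mps_const c * f) m = c * mps_coeff f m"
  for f :: "('v, 'a::comm_ring_1) mps"
proof -
  have "mps_coeff (mps_const c * f) m =
      (\<Sum>(m1, m2)\<in>{(0 :: 'v \<Rightarrow>\<^sub>0 nat, m)}. mps_coeff (mps_const c) m1 * mps_coeff f m2)"
    unfolding mps_coeff_mult
    by (rule sum.mono_neutral_right [OF finite_splits])
       (auto simp: splits_def mps_const_def split: if_splits)
  then show ?thesis by (simp add: mps_const_def)
qed

lemma mps_const_0 [simp]: "mps_const 0 = 0"
  by (rule mps_eqI) (simp add: mps_const_def)

lemma mps_const_1 [simp]: "mps_const 1 = 1"
  by (rule mps_eqI) (simp add: mps_const_def mps_coeff_1)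

lemma mps_const_add: "mps_const (c + c') = mps_const c + (mps_const c' :: ('v, 'a::comm_ring_1) mps)"
  by (rule mps_eqI) (simp add: mps_const_def)

lemma mps_const_mult: "mps_const (c * c') = mps_const c * (mps_const c' :: ('v, 'a::comm_ring_1) mps)"
  by (rule mps_eqI) (simp only: mps_coeff_const_mult, simp add: mps_const_def)

lemma mps_const_of_nat: "mps_const (of_nat n) = (of_nat n :: ('v, 'a::comm_ring_1) mps)"
  by (induction n) (simp_all add: mps_const_add)

lemma mps_deriv_add: "mps_deriv v (f + g) = mps_deriv v f + mps_deriv v g"
  for f :: "('v, 'a::comm_ring_1) mps"
  by (rule mps_eqI) (simp add: mps_coeff_deriv algebra_simps)

lemma mps_deriv_0 [simp]: "mps_deriv v (0 :: ('v, 'a::comm_ring_1) mps) = 0"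
  by (rule mps_eqI) (simp add: mps_coeff_deriv)

lemma mps_deriv_sum: "mps_deriv v (sum f A) = (\<Sum>i\<in>A. mps_deriv v (f i))"
  for f :: "'i \<Rightarrow> ('v, 'a::comm_ring_1) mps"
  by (induction A rule: infinite_finite_induct) (auto simp: mps_deriv_add)

lemma add_single_neq_0: "m + Poly_Mapping.single v (Suc n) \<noteq> 0" for m :: "'v \<Rightarrow>\<^sub>0 nat"
proof
  assume "m + Poly_Mapping.single v (Suc n) = 0"
  then have "Poly_Mapping.lookup (m + Poly_Mapping.single v (Suc n)) v = 0" by simp
  then show False by (simp add: lookup_add)
qed

lemma mps_deriv_const [simp]: "mps_deriv v (mps_const c :: ('v, 'a::comm_ring_1) mps) = 0"
  using add_single_neq_0 [of _ v 0]
  by (intro mps_eqI) (simp add: mps_coeff_deriv mps_const_def)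

lemma mps_deriv_1 [simp]: "mps_deriv v (1 :: ('v, 'a::comm_ring_1) mps) = 0"
  using mps_deriv_const [of v "1 :: 'a"] by simp

lemma mps_deriv_var:
  "mps_deriv v (mps_var w) = (if v = w then 1 else 0 :: ('v, 'a::comm_ring_1) mps)"
proof (rule mps_eqI)
  fix m :: "'v \<Rightarrow>\<^sub>0 nat"
  have "m + Poly_Mapping.single v 1 = Poly_Mapping.single w 1 \<longleftrightarrow> v = w \<and> m = 0"
  proof
    assume *: "m + Poly_Mapping.single v 1 = Poly_Mapping.single w 1"
    then have "Poly_Mapping.lookup (m + Poly_Mapping.single v 1) v = Poly_Mapping.lookup (Poly_Mapping.single w 1) v"
      by simp
    then have "v = w" by (auto simp: lookup_add lookup_single when_def split: if_splits)
    with * show "v = w \<and> m = 0" by simp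
  qed simp
  then show "mps_coeff (mps_deriv v (mps_var w)) m = mps_coeff (if v = w then 1 else 0 :: ('v, 'a) mps) m"
    by (auto simp: mps_coeff_deriv mps_var_def mps_coeff_1)
qed

text \<open>One half of the product rule: the weight kills every splitting whose first part lacks
  \<open>v\<close>, and lowering the exponent of \<open>v\<close> by one in the first part matches
  the remaining ones with the splittings of \<open>m\<close>.\<close>

lemma sum_splits_shift:
  fixes F :: "('v \<Rightarrow>\<^sub>0 nat) \<Rightarrow> ('v \<Rightarrow>\<^sub>0 nat) \<Rightarrow> 'a::comm_ring_1"
  shows "(\<Sum>(m1, m2)\<in>splits (m + Poly_Mapping.single v 1). of_nat (Poly_Mapping.lookup m1 v) * F m1 m2) =
    (\<Sum>(m1, m2)\<in>splits m. of_nat (Poly_Mapping.lookup m1 v + 1) * F (m1 + Poly_Mapping.single v 1) m2)"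
proof -
  let ?s = "Poly_Mapping.single v (1::nat)"
  \<comment> \<open>Subtraction of exponents is truncated, so adding \<open>?s\<close> back undoes
    it only when \<open>v\<close> occurs in \<open>m1\<close>.\<close>
  have shift: "m1 - ?s + ?s = m1" if "Poly_Mapping.lookup m1 v \<noteq> 0" for m1
    using that by (intro poly_mapping_eqI) (auto simp: lookup_add lookup_minus lookup_single when_def)
  have "(\<Sum>(m1, m2)\<in>splits (m + ?s). of_nat (Poly_Mapping.lookup m1 v) * F m1 m2) =
      (\<Sum>(m1, m2)\<in>{p \<in> splits (m + ?s). Poly_Mapping.lookup (fst p) v \<noteq> 0}.
        of_nat (Poly_Mapping.lookup m1 v) * F m1 m2)"
    by (rule sum.mono_neutral_right [OF finite_splits]) (auto intro!: gr0I)
  also have "\<dots> = (\<Sum>(m1, m2)\<in>splits m. of_nat (Poly_Mapping.lookup m1 v + 1) * F (m1 + ?s) m2)"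
  proof (rule sum.reindex_bij_witness [where i = "\<lambda>(m1, m2). (m1 + ?s, m2)" and j = "\<lambda>(m1, m2). (m1 - ?s, m2)"],
      goal_cases)
    case (1 p)
    then show ?case using shift [of "fst p"] by (simp add: case_prod_unfold)
  next
    case (2 p)
    obtain m1 m2 where p: "p = (m1, m2)" by (cases p)
    have "(m1 - ?s + m2) + ?s = (m1 - ?s + ?s) + m2" by (simp only: ac_simps)
    also have "\<dots> = m + ?s" using 2 shift [of m1] by (simp add: p splits_def)
    finally show ?case by (simp add: p splits_def)
  next
    case (3 p)
    then show ?case by (simp add: case_prod_unfold)
  next
    case (4 p)
    obtain m1 m2 where p: "p = (m1, m2)" by (cases p)
    have "m1 + ?s + m2 = (m1 + m2) + ?s" by (simp only: ac_simps)
    also have "\<dots> = m + ?s" using 4 by (simp add: p splits_def)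
    finally show ?case by (simp add: p splits_def lookup_add)
  next
    case (5 p)
    then have "Poly_Mapping.lookup (fst p - ?s) v + 1 = Poly_Mapping.lookup (fst p) v"
      by (simp add: lookup_minus)
    then show ?case
      using 5 shift [of "fst p"]
      by (simp add: case_prod_unfold del: of_nat_add of_nat_Suc One_nat_def add_Suc_right)
  qed
  finally show ?thesis .
qed

text \<open>The factor \<open>lookup m v + 1\<close> is the exponent of \<open>v\<close> in
  \<open>m + ?s\<close>. In each splitting it is the sum of the exponents in the two parts, and
  these two summands yield the two terms of the rule.\<close>

lemma mps_deriv_mult: "mps_deriv v (f * g) = mps_deriv v f * g + f * mps_deriv v g"
  for f g :: "('v, 'a::comm_ring_1) mps"
proof (rule mps_eqI)
  fix m
  let ?s = "Poly_Mapping.single v (1::nat)"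
  let ?S = "splits (m + ?s)"
  have half: "(\<Sum>(m1, m2)\<in>?S. of_nat (Poly_Mapping.lookup m1 v) * (mps_coeff f m1 * mps_coeff g m2)) =
      mps_coeff (mps_deriv v f * g) m" for f g :: "('v, 'a) mps"
    unfolding sum_splits_shift [where F = "\<lambda>m1 m2. mps_coeff f m1 * mps_coeff g m2"]
    by (simp add: mps_coeff_mult mps_coeff_deriv mult.assoc del: of_nat_add of_nat_Suc)
  have swap: "(\<Sum>(m1, m2)\<in>?S. of_nat (Poly_Mapping.lookup m2 v) * (mps_coeff f m1 * mps_coeff g m2)) =
      (\<Sum>(m1, m2)\<in>?S. of_nat (Poly_Mapping.lookup m1 v) * (mps_coeff g m1 * mps_coeff f m2))"
    by (rule sum.reindex_bij_witness [where i = prod.swap and j = prod.swap])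
       (auto simp: splits_def ac_simps)
  have "mps_coeff (mps_deriv v (f * g)) m =
      (\<Sum>(m1, m2)\<in>?S. of_nat (Poly_Mapping.lookup m v + 1) * (mps_coeff f m1 * mps_coeff g m2))"
    by (simp add: mps_coeff_deriv mps_coeff_mult sum_distrib_left case_prod_unfold)
  also have "\<dots> = (\<Sum>(m1, m2)\<in>?S. of_nat (Poly_Mapping.lookup m1 v) * (mps_coeff f m1 * mps_coeff g m2)
      + of_nat (Poly_Mapping.lookup m2 v) * (mps_coeff f m1 * mps_coeff g m2))"
  proof (rule sum.cong, goal_cases)
    case (2 p)
    then have "Poly_Mapping.lookup (fst p + snd p) v = Poly_Mapping.lookup (m + ?s) v"
      by (auto simp: splits_def)
    then have "Poly_Mapping.lookup m v + 1 = Poly_Mapping.lookup (fst p) v + Poly_Mapping.lookup (snd p) v"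
      by (simp add: lookup_add)
    then show ?case by (simp only: case_prod_unfold of_nat_add distrib_right)
  qed simp
  also have "\<dots> = mps_coeff (mps_deriv v f * g + f * mps_deriv v g) m"
    using half [of f g] half [of g f] swap
    by (simp add: sum.distrib case_prod_unfold mult.commute [of f])
  finally show "mps_coeff (mps_deriv v (f * g)) m = mps_coeff (mps_deriv v f * g + f * mps_deriv v g) m" .
qed

lemma mps_deriv_prod:
  fixes f :: "'i \<Rightarrow> ('v, 'a::comm_ring_1) mps"
  assumes "finite A"
  shows "mps_deriv v (prod f A) = (\<Sum>i\<in>A. mps_deriv v (f i) * prod f (A - {i}))"
  using assms
proof induction
  case (insert j A)
  have "prod f (insert j A - {i}) = f j * prod f (A - {i})" if "i \<in> A" for i
  proof -
    have "insert j A - {i} = insert j (A - {i})" using that insert.hyps by auto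
    then show ?thesis using insert.hyps by simp
  qed
  moreover have "insert j A - {j} = A" using insert.hyps by auto
  ultimately show ?case
    using insert by (simp add: mps_deriv_mult sum_distrib_left mult.left_commute)
qed simp

lemma mps_deriv_power:
  "mps_deriv v (f ^ n) = of_nat n * f ^ (n - 1) * mps_deriv v f"
  for f :: "('v, 'a::comm_ring_1) mps"
proof (induction n)
  case (Suc n)
  then show ?case by (cases n) (simp_all add: mps_deriv_mult algebra_simps)
qed simp


section \<open>Substitution into polynomials in the power sums\<close>

text \<open>The form of \<open>to_xseries\<close> with arbitrary values \<open>g k\<close> in place
  of \<open>power_sum k\<close>, so that the traces of a finite matrix can be substituted
  too.\<close>

definition psubst :: "(nat \<Rightarrow> xseries) \<Rightarrow> ppoly \<Rightarrow> xseries"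
  where "psubst g P = (\<Sum>m\<in>Poly_Mapping.keys P. mps_const (Poly_Mapping.lookup P m) *
    (\<Prod>k\<in>Poly_Mapping.keys m. g k ^ Poly_Mapping.lookup m k))"

text \<open>Allows polynomials with different monomials to be summed over one index set, where
  additivity holds term by term.\<close>

lemma psubst_superset:
  assumes "finite A" "Poly_Mapping.keys P \<subseteq> A"
  shows "psubst g P = (\<Sum>m\<in>A. mps_const (Poly_Mapping.lookup P m) *
    (\<Prod>k\<in>Poly_Mapping.keys m. g k ^ Poly_Mapping.lookup m k))"
  unfolding psubst_def
  by (rule sum.mono_neutral_left) (use assms in \<open>auto simp: in_keys_iff\<close>)

lemma psubst_0 [simp]: "psubst g 0 = 0"
  by (simp add: psubst_def)

lemma psubst_add: "psubst g (P + Q) = psubst g P + psubst g Q"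
proof -
  let ?A = "Poly_Mapping.keys P \<union> Poly_Mapping.keys Q"
  have fin: "finite ?A" by simp
  show ?thesis
    unfolding psubst_superset [OF fin Un_upper1] psubst_superset [OF fin Un_upper2]
      psubst_superset [OF fin keys_add]
    by (simp add: lookup_add mps_const_add algebra_simps sum.distrib)
qed

lemma psubst_sum: "psubst g (sum f A) = (\<Sum>i\<in>A. psubst g (f i))"
  by (induction A rule: infinite_finite_induct) (auto simp: psubst_add)

lemma psubst_single:
  assumes "finite S" "Poly_Mapping.keys m \<subseteq> S"
  shows "psubst g (Poly_Mapping.single m c) = mps_const c * (\<Prod>k\<in>S. g k ^ Poly_Mapping.lookup m k)"
proof -
  have "(\<Prod>k\<in>Poly_Mapping.keys m. g k ^ Poly_Mapping.lookup m k) = (\<Prod>k\<in>S. g k ^ Poly_Mapping.lookup m k)"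
    by (rule prod.mono_neutral_left) (use assms in \<open>auto simp: in_keys_iff\<close>)
  then show ?thesis by (cases "c = 0") (simp_all add: psubst_def)
qed

lemma ppoly_eq_sum_single:
  "P = (\<Sum>m\<in>Poly_Mapping.keys P. Poly_Mapping.single m (Poly_Mapping.lookup P m))"
  for P :: ppoly
  by (rule poly_mapping_eqI) (simp add: lookup_sum lookup_single when_def in_keys_iff)

text \<open>On monomials this is additivity of exponents; bilinearity does the rest.\<close>

lemma psubst_mult: "psubst g (P * Q) = psubst g P * psubst g Q"
proof -
  have single: "psubst g (Poly_Mapping.single m c * Poly_Mapping.single m' c') =
      psubst g (Poly_Mapping.single m c) * psubst g (Poly_Mapping.single m' c')" for m m' c c'
  proof -
    let ?S = "Poly_Mapping.keys m \<union> Poly_Mapping.keys m'"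
    have fin: "finite ?S" by simp
    show ?thesis
      unfolding mult_single psubst_single [OF fin Un_upper1] psubst_single [OF fin Un_upper2]
        psubst_single [OF fin keys_add]
      by (simp add: lookup_add power_add prod.distrib mps_const_mult ac_simps)
  qed
  have "psubst g (P * Q) = psubst g ((\<Sum>m\<in>Poly_Mapping.keys P. Poly_Mapping.single m (Poly_Mapping.lookup P m)) *
      (\<Sum>m\<in>Poly_Mapping.keys Q. Poly_Mapping.single m (Poly_Mapping.lookup Q m)))"
    by (simp only: ppoly_eq_sum_single [symmetric])
  also have "\<dots> = psubst g (\<Sum>m\<in>Poly_Mapping.keys P. Poly_Mapping.single m (Poly_Mapping.lookup P m)) *
      psubst g (\<Sum>m\<in>Poly_Mapping.keys Q. Poly_Mapping.single m (Poly_Mapping.lookup Q m))"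
    by (simp only: sum_product psubst_sum single)
  finally show ?thesis by (simp only: ppoly_eq_sum_single [symmetric])
qed

lemma psubst_const [simp]: "psubst g (Poly_Mapping.single 0 c) = mps_const c"
  by (simp add: psubst_single [of "{}"])

lemma psubst_1 [simp]: "psubst g 1 = 1"
  using psubst_const [of g 1] by simp

lemma psubst_of_nat: "psubst g (of_nat n) = of_nat n"
  by (induction n) (simp_all add: psubst_add)

lemma psubst_prod: "psubst g (prod f A) = (\<Prod>i\<in>A. psubst g (f i))"
  by (induction A rule: infinite_finite_induct) (auto simp: psubst_mult)

lemma psubst_pvar: "psubst g (pvar k) = g k"
  unfolding pvar_def by (subst psubst_single [of "{k}"]) simp_all

section \<open>Partial derivatives of polynomials and the chain rule\<close>

lemma deriv_p_add: "deriv_p k (P + Q) = deriv_p k P + deriv_p k Q"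
  by (rule poly_mapping_eqI) (simp add: deriv_p.rep_eq lookup_add algebra_simps)

lemma deriv_p_sum: "deriv_p k (sum f A) = (\<Sum>i\<in>A. deriv_p k (f i))"
proof -
  have "deriv_p k 0 = 0" by (rule poly_mapping_eqI) (simp add: deriv_p.rep_eq)
  then show ?thesis
    by (induction A rule: infinite_finite_induct) (auto simp: deriv_p_add)
qed

lemma deriv_p_single:
  "deriv_p k (Poly_Mapping.single m c) =
    Poly_Mapping.single (m - Poly_Mapping.single k 1) (of_nat (Poly_Mapping.lookup m k) * c)"
proof (rule poly_mapping_eqI)
  fix n
  let ?s = "Poly_Mapping.single k (1::nat)"
  have "m = n + ?s \<longleftrightarrow> Poly_Mapping.lookup m k \<noteq> 0 \<and> m - ?s = n"
  proof
    assume "m = n + ?s"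
    then show "Poly_Mapping.lookup m k \<noteq> 0 \<and> m - ?s = n"
      by (simp add: lookup_add)
  next
    assume "Poly_Mapping.lookup m k \<noteq> 0 \<and> m - ?s = n"
    then show "m = n + ?s"
      by (intro poly_mapping_eqI) (auto simp: lookup_add lookup_minus lookup_single when_def)
  qed
  note eq = this
  show "Poly_Mapping.lookup (deriv_p k (Poly_Mapping.single m c)) n = Poly_Mapping.lookup
      (Poly_Mapping.single (m - ?s) (of_nat (Poly_Mapping.lookup m k) * c)) n"
  proof (cases "m = n + ?s")
    case True
    then show ?thesis by (simp add: deriv_p.rep_eq lookup_add)
  next
    case False
    \<comment> \<open>If \<open>k\<close> does not occur in \<open>m\<close>, truncated subtraction
      leaves \<open>m\<close> unchanged, but then the coefficient on the right is 0.\<close>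
    then have "Poly_Mapping.lookup m k = 0 \<or> m - ?s \<noteq> n" using eq by blast
    with False show ?thesis
      by (auto simp: deriv_p.rep_eq lookup_single_not_eq simp del: One_nat_def)
  qed
qed

text \<open>The chain rule, checked on monomials and extended by linearity. A free finite
  \<open>S\<close> gives all monomials of \<open>P\<close> the same range of summation.\<close>

lemma mps_deriv_psubst:
  assumes "finite S" "pvars P \<subseteq> S"
  shows "mps_deriv v (psubst g P) = (\<Sum>k\<in>S. psubst g (deriv_p k P) * mps_deriv v (g k))"
proof -
  have single: "mps_deriv v (psubst g (Poly_Mapping.single m c)) =
      (\<Sum>k\<in>S. psubst g (deriv_p k (Poly_Mapping.single m c)) * mps_deriv v (g k))"
    if m: "Poly_Mapping.keys m \<subseteq> S" for m c
  proof -
    let ?e = "Poly_Mapping.lookup m"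
    have D: "psubst g (deriv_p k (Poly_Mapping.single m c)) =
        mps_const c * (of_nat (?e k) * g k ^ (?e k - 1) * (\<Prod>j\<in>S - {k}. g j ^ ?e j))" if k: "k \<in> S" for k
    proof -
      have sub: "Poly_Mapping.keys (m - Poly_Mapping.single k 1) \<subseteq> S"
        using m by (auto simp: in_keys_iff lookup_minus)
      have "(\<Prod>j\<in>S - {k}. g j ^ (?e j - Poly_Mapping.lookup (Poly_Mapping.single k 1) j)) = (\<Prod>j\<in>S - {k}. g j ^ ?e j)"
        by (rule prod.cong) (auto simp: lookup_single when_def)
      then show ?thesis
        unfolding deriv_p_single psubst_single [OF assms(1) sub] prod.remove [OF assms(1) k]
        by (simp add: mps_const_mult mps_const_of_nat lookup_minus ac_simps)
    qed
    have "mps_deriv v (psubst g (Poly_Mapping.single m c)) =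
        mps_const c * (\<Sum>k\<in>S. (of_nat (?e k) * g k ^ (?e k - 1) * mps_deriv v (g k)) * (\<Prod>j\<in>S - {k}. g j ^ ?e j))"
      unfolding psubst_single [OF assms(1) m]
      by (simp add: mps_deriv_mult mps_deriv_prod [OF assms(1)] mps_deriv_power)
    then show ?thesis
      by (simp add: D sum_distrib_left ac_simps)
  qed
  let ?P = "\<Sum>m\<in>Poly_Mapping.keys P. Poly_Mapping.single m (Poly_Mapping.lookup P m)"
  have "mps_deriv v (psubst g ?P) = (\<Sum>m\<in>Poly_Mapping.keys P.
      \<Sum>k\<in>S. psubst g (deriv_p k (Poly_Mapping.single m (Poly_Mapping.lookup P m))) * mps_deriv v (g k))"
    using assms(2) unfolding psubst_sum mps_deriv_sum pvars_def
    by (intro sum.cong refl single) auto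
  also have "\<dots> = (\<Sum>k\<in>S. psubst g (deriv_p k ?P) * mps_deriv v (g k))"
    unfolding deriv_p_sum psubst_sum sum_distrib_right by (rule sum.swap)
  finally show ?thesis by (simp only: ppoly_eq_sum_single [symmetric])
qed


section \<open>Powers and traces of a finite matrix of indeterminates\<close>

text \<open>Powers of the matrix of indeterminates with inner indices confined to \<open>I\<close>.
  The recursion copies that of \<open>X_power\<close>, so truncation can compare the two step by
  step.\<close>

primrec mat_pow :: "nat set \<Rightarrow> nat \<Rightarrow> nat \<Rightarrow> nat \<Rightarrow> xseries"
  where
    "mat_pow I 0 a b = (if a = b then 1 else 0)"
  | "mat_pow I (Suc k) a b = (\<Sum>c\<in>I. mat_pow I k a c * Xvar c b)"

definition mat_tr :: "nat set \<Rightarrow> nat \<Rightarrow> xseries"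
  where "mat_tr I k = (\<Sum>a\<in>I. mat_pow I k a a)"

lemma mat_pow_add:
  assumes "finite I" "b \<in> I"
  shows "(\<Sum>c\<in>I. mat_pow I k a c * mat_pow I l c b) = mat_pow I (k + l) a b"
  using assms(2)
proof (induction l arbitrary: b)
  case 0
  have "(\<Sum>c\<in>I. mat_pow I k a c * mat_pow I 0 c b) = (\<Sum>c\<in>I. if c = b then mat_pow I k a c else 0)"
    by (rule sum.cong) auto
  then show ?case using assms(1) 0 by simp
next
  case (Suc l)
  have "(\<Sum>c\<in>I. mat_pow I k a c * mat_pow I (Suc l) c b) =
      (\<Sum>c\<in>I. \<Sum>c'\<in>I. mat_pow I k a c * mat_pow I l c c' * Xvar c' b)"
    by (simp add: sum_distrib_left mult.assoc)
  also have "\<dots> = (\<Sum>c'\<in>I. (\<Sum>c\<in>I. mat_pow I k a c * mat_pow I l c c') * Xvar c' b)"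
    by (subst sum.swap) (simp add: sum_distrib_right)
  also have "\<dots> = (\<Sum>c'\<in>I. mat_pow I (k + l) a c' * Xvar c' b)"
    by (intro sum.cong) (simp_all add: Suc.IH)
  finally show ?case by simp
qed

lemma mat_pow_Suc_left:
  assumes "finite I" "a \<in> I" "b \<in> I"
  shows "(\<Sum>c\<in>I. Xvar a c * mat_pow I k c b) = mat_pow I (Suc k) a b"
proof -
  have "mat_pow I 1 a c = Xvar a c" for c
  proof -
    have "mat_pow I 1 a c = (\<Sum>c'\<in>I. if a = c' then Xvar c' c else 0)"
      unfolding One_nat_def mat_pow.simps by (rule sum.cong) auto
    then show ?thesis using assms by simp
  qed
  then show ?thesis using mat_pow_add [OF assms(1,3), of 1 a k] by simp
qed

text \<open>The derivation removes one of the \<open>k\<close> factors; \<open>r\<close> counts the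
  factors to its left, and the removed factor leaves the open indices \<open>x\<close> and
  \<open>y\<close>.\<close>

lemma mps_deriv_mat_pow:
  assumes "finite I" "x \<in> I"
  shows "mps_deriv (x, y) (mat_pow I k a b) = (\<Sum>r<k. mat_pow I r a x * mat_pow I (k - Suc r) y b)"
proof (induction k arbitrary: b)
  case (Suc k)
  have "mps_deriv (x, y) (mat_pow I (Suc k) a b) =
      (\<Sum>c\<in>I. mps_deriv (x, y) (mat_pow I k a c) * Xvar c b) +
      (\<Sum>c\<in>I. mat_pow I k a c * mps_deriv (x, y) (Xvar c b))"
    by (simp add: mps_deriv_sum mps_deriv_mult sum.distrib)
  also have "(\<Sum>c\<in>I. mps_deriv (x, y) (mat_pow I k a c) * Xvar c b) =
      (\<Sum>r<k. mat_pow I r a x * mat_pow I (Suc (k - Suc r)) y b)"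
    unfolding Suc.IH mat_pow.simps sum_distrib_left sum_distrib_right mult.assoc by (rule sum.swap)
  also have "\<dots> = (\<Sum>r<k. mat_pow I r a x * mat_pow I (Suc k - Suc r) y b)"
    by (rule sum.cong) (auto simp: Suc_diff_Suc simp del: mat_pow.simps)
  \<comment> \<open>Removing the last factor forces \<open>c = x\<close> and \<open>b = y\<close>;
    \<open>mat_pow I 0 y b\<close> records the second condition, and the result is the summand
    \<open>r = k\<close>.\<close>
  also have "(\<Sum>c\<in>I. mat_pow I k a c * mps_deriv (x, y) (Xvar c b)) =
      (\<Sum>c\<in>I. if x = c then mat_pow I k a c * mat_pow I 0 y b else 0)"
    by (rule sum.cong) (auto simp: Xvar_def mps_deriv_var)
  also have "\<dots> = mat_pow I k a x * mat_pow I 0 y b"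
    using assms by simp
  finally show ?case by (simp del: mat_pow.simps)
qed simp

text \<open>Closing up the trace joins the two pieces of the cut power the other way round, so all
  \<open>k\<close> cuts give the same entry.\<close>

lemma mps_deriv_mat_tr:
  assumes "finite I" "x \<in> I" "y \<in> I"
  shows "mps_deriv (x, y) (mat_tr I k) = of_nat k * mat_pow I (k - 1) y x"
proof -
  have "mps_deriv (x, y) (mat_tr I k) =
      (\<Sum>r<k. \<Sum>a\<in>I. mat_pow I (k - Suc r) y a * mat_pow I r a x)"
    unfolding mat_tr_def mps_deriv_sum mps_deriv_mat_pow [OF assms(1,2)]
    by (subst sum.swap) (simp add: mult.commute)
  also have "\<dots> = (\<Sum>r<k. mat_pow I (k - 1) y x)"
    by (rule sum.cong) (simp_all add: mat_pow_add [OF assms(1,2)])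
  finally show ?thesis by simp
qed


section \<open>Inserting a point into a cycle\<close>

lemma permutes_insert_transpose:
  assumes "\<delta> permutes {1..n}" "i \<in> {1..Suc n}"
  shows "\<delta> \<circ> transpose i (Suc n) permutes {1..Suc n}"
proof (rule permutes_compose)
  show "\<delta> permutes {1..Suc n}" by (rule permutes_subset [OF assms(1)]) auto
  show "transpose i (Suc n) permutes {1..Suc n}" by (rule permutes_swap_id) (use assms in auto)
qed

text \<open>A permutation either fixes \<open>Suc n\<close> or has the form
  \<open>\<delta> \<circ> transpose i (Suc n)\<close> for exactly one pair of \<delta> and
  \<open>i\<close>, where \<open>i\<close> is the preimage of \<open>Suc n\<close>.\<close>

lemma sum_permutes_Suc:
  "(\<Sum>\<delta> | \<delta> permutes {1..Suc n}. f \<delta>) =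
    (\<Sum>\<delta> | \<delta> permutes {1..n}. f \<delta> + (\<Sum>i=1..n. f (\<delta> \<circ> transpose i (Suc n))))"
  for f :: "(nat \<Rightarrow> nat) \<Rightarrow> 'a::comm_monoid_add"
proof -
  have ins: "{1..Suc n} = insert (Suc n) {1..n}" by auto
  have "(\<Sum>\<delta> | \<delta> permutes {1..Suc n}. f \<delta>) =
      (\<Sum>\<delta> | \<delta> permutes {1..n}. \<Sum>b\<in>insert (Suc n) {1..n}. f (transpose (Suc n) b \<circ> \<delta>))"
    unfolding ins by (subst sum_over_permutations_insert) (simp_all only: finite_atLeastAtMost sum.swap [of _ "insert _ _"], simp)
  also have "\<dots> = (\<Sum>\<delta> | \<delta> permutes {1..n}. f \<delta> + (\<Sum>i=1..n. f (\<delta> \<circ> transpose i (Suc n))))"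
  proof (rule sum.cong [OF refl])
    fix \<delta> assume "\<delta> \<in> {\<delta>. \<delta> permutes {1..n}}"
    then have \<delta>: "\<delta> permutes {1..n}" by simp
    \<comment> \<open>Conjugation by \<delta>, which fixes \<open>Suc n\<close>, moves the
      transposition from the left to the right; the reindexing \<open>b = \<delta> i\<close> then
      gives the stated form.\<close>
    have tr: "transpose (Suc n) (\<delta> i) \<circ> \<delta> = \<delta> \<circ> transpose i (Suc n)" for i
    proof -
      have "\<delta> (Suc n) = Suc n" using \<delta> by (auto simp: permutes_def)
      then have "transpose (Suc n) (\<delta> i) = transpose (\<delta> i) (\<delta> (Suc n))"
        by (simp add: transpose_commute)
      then show ?thesis
        using permutes_inj [OF \<delta>] by (auto simp: fun_eq_iff transpose_def inj_eq)
    qed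
    have "(\<Sum>b=1..n. f (transpose (Suc n) b \<circ> \<delta>)) = (\<Sum>i=1..n. f (transpose (Suc n) (\<delta> i) \<circ> \<delta>))"
      by (rule sum.permute [OF \<delta>, unfolded comp_def])
    then show "(\<Sum>b\<in>insert (Suc n) {1..n}. f (transpose (Suc n) b \<circ> \<delta>)) =
        f \<delta> + (\<Sum>i=1..n. f (\<delta> \<circ> transpose i (Suc n)))"
      by (simp add: tr)
  qed
  finally show ?thesis .
qed

lemma permutes_SucE:
  assumes "\<phi> permutes {1..Suc n}"
  obtains "\<phi> permutes {1..n}"
    | \<phi>' i where "\<phi>' permutes {1..n}" "i \<in> {1..n}" "\<phi> = \<phi>' \<circ> transpose i (Suc n)"
proof -
  define i where "i = inv \<phi> (Suc n)"
  have \<phi>i: "\<phi> i = Suc n" unfolding i_def using permutes_surj [OF assms] by (simp add: surj_f_inv_f)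
  have i: "i \<in> {1..Suc n}" using \<phi>i permutes_in_image [OF assms, of i] by simp
  define \<phi>' where "\<phi>' = \<phi> \<circ> transpose i (Suc n)"
  have "\<phi>' permutes {1..Suc n}" unfolding \<phi>'_def
    by (rule permutes_compose [OF _ assms], rule permutes_swap_id) (use i in auto)
  then have \<phi>': "\<phi>' permutes {1..n}"
    by (rule permutes_superset) (use \<phi>i in \<open>auto simp: \<phi>'_def le_Suc_eq\<close>)
  have \<phi>: "\<phi> = \<phi>' \<circ> transpose i (Suc n)" by (simp add: \<phi>'_def fun_eq_iff)
  show ?thesis
  proof (cases "i = Suc n")
    case True
    then have "\<phi> = \<phi>'" using \<phi> by simp
    with \<phi>' show ?thesis using that(1) by simp
  next
    case False
    then show ?thesis using that(2) [OF \<phi>' _ \<phi>] i by auto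
  qed
qed

text \<open>The new permutation runs \<open>i\<close>, \<open>Suc n\<close>,
  \<open>\<delta> i\<close> and otherwise agrees with \<delta> on \<open>{1..n}\<close>, so only the
  cycle through \<open>i\<close> grows.\<close>

lemma orbit_comp_transpose:
  assumes \<delta>: "\<delta> permutes {1..n}" and i: "i \<in> {1..n}" and x: "x \<in> {1..n}"
  shows "orbit (\<delta> \<circ> transpose i (Suc n)) x =
    (if i \<in> orbit \<delta> x then insert (Suc n) (orbit \<delta> x) else orbit \<delta> x)"
proof -
  define \<rho> where "\<rho> = \<delta> \<circ> transpose i (Suc n)"
  have fix_Suc: "\<delta> (Suc n) = Suc n" using \<delta> by (auto simp: permutes_def)
  have eq: "\<rho> i = Suc n" "\<rho> (Suc n) = \<delta> i" "\<And>y. y \<noteq> i \<Longrightarrow> y \<noteq> Suc n \<Longrightarrow> \<rho> y = \<delta> y"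
    using i fix_Suc by (auto simp: \<rho>_def transpose_def)
  have sub: "orbit \<delta> x \<subseteq> {1..n}" using cycles_permutes(2) [OF \<delta> x] .
  have fwd: "y \<in> orbit \<delta> x \<or> i \<in> orbit \<delta> x \<and> y = Suc n" if "y \<in> orbit \<rho> x" for y
    using that
  proof induction
    case base
    show ?case using eq x orbit.base [of \<delta> x] cycles_permutes(1) [OF \<delta> i]
      by (cases "x = i") auto
  next
    case (step y)
    then show ?case using eq orbit.step [of _ \<delta> x] sub
      by (cases "y = i"; cases "y = Suc n") fastforce+
  qed
  \<comment> \<open>One step of \<delta> is one step of \<rho>, except at \<open>i\<close>, where
    two steps lead through \<open>Suc n\<close>.\<close>
  have bwd: "y \<in> orbit \<rho> x" if "y \<in> orbit \<delta> x" for y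
    using that
  proof induction
    case base
    show ?case
    proof (cases "x = i")
      case True
      then have "Suc n \<in> orbit \<rho> x" using orbit.base [of \<rho> x] eq by simp
      then have "\<rho> (Suc n) \<in> orbit \<rho> x" by (rule orbit.step)
      then show ?thesis using eq True by simp
    next
      case False
      then show ?thesis using orbit.base [of \<rho> x] eq(3) [of x] x by simp
    qed
  next
    case (step y)
    show ?case
    proof (cases "y = i")
      case True
      then have "Suc n \<in> orbit \<rho> x" using orbit.step [OF step.IH] eq by simp
      then have "\<rho> (Suc n) \<in> orbit \<rho> x" by (rule orbit.step)
      then show ?thesis using eq True by simp
    next
      case False
      moreover have "y \<noteq> Suc n" using step.hyps sub by auto
      ultimately show ?thesis using orbit.step [OF step.IH] eq(3) [of y] by simp
    qed
  qed
  have "Suc n \<in> orbit \<rho> x" if "i \<in> orbit \<delta> x"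
    using orbit.step [OF bwd [OF that]] eq by simp
  with fwd bwd show ?thesis unfolding \<rho>_def [symmetric] by auto
qed

text \<open>Cycles are recorded only by their sets of elements, so the place after \<open>i\<close>
  shows up merely as membership in the cycle of \<open>i\<close>.\<close>

definition insert_after :: "nat \<Rightarrow> nat \<Rightarrow> nat set \<Rightarrow> nat set"
  where "insert_after i j C = (if i \<in> C then insert j C else C)"

lemma cycles_subset: "\<delta> permutes {1..n} \<Longrightarrow> C \<in> cycles n \<delta> \<Longrightarrow> C \<subseteq> {1..n}"
  unfolding cycles_def using cycles_permutes(2) by blast

lemma cycles_comp_transpose:
  assumes \<delta>: "\<delta> permutes {1..n}" and i: "i \<in> {1..n}"
  shows "cycles (Suc n) (\<delta> \<circ> transpose i (Suc n)) = insert_after i (Suc n) ` cycles n \<delta>"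
proof -
  let ?\<delta> = "\<delta> \<circ> transpose i (Suc n)"
  have perm: "?\<delta> permutes {1..Suc n}" by (rule permutes_insert_transpose) (use assms in auto)
  have orb: "orbit ?\<delta> x = insert_after i (Suc n) (orbit \<delta> x)" if "x \<in> {1..n}" for x
    unfolding insert_after_def by (rule orbit_comp_transpose [OF assms that])
  have "Suc n \<in> orbit ?\<delta> i"
    using orbit_comp_transpose [OF assms i] cycles_permutes(1) [OF assms] by simp
  then have "orbit ?\<delta> (Suc n) = orbit ?\<delta> i"
    using orbit_cyclic_eq3 [OF cyclic_on_orbit [OF perm finite_atLeastAtMost]] by blast
  moreover have "{1..Suc n} = insert (Suc n) {1..n}" by auto
  ultimately have "cycles (Suc n) ?\<delta> = orbit ?\<delta> ` {1..n}"
    using i by (auto simp: cycles_def)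
  also have "\<dots> = insert_after i (Suc n) ` cycles n \<delta>"
    unfolding cycles_def image_image by (rule image_cong [OF refl orb])
  finally show ?thesis .
qed

lemma inj_on_insert_after_cycles:
  assumes "\<delta> permutes {1..n}"
  shows "inj_on (insert_after i (Suc n)) (cycles n \<delta>)"
proof (rule inj_onI)
  fix C C' assume "C \<in> cycles n \<delta>" "C' \<in> cycles n \<delta>"
  then have "Suc n \<notin> C" "Suc n \<notin> C'" using cycles_subset [OF assms] by fastforce+
  then show "insert_after i (Suc n) C = insert_after i (Suc n) C' \<Longrightarrow> C = C'"
    unfolding insert_after_def by (metis insertI1 insert_ident)
qed

text \<open>The weight of the inserted point is moved onto \<open>i\<close>. This makes the cycle
  sums of the enlarged permutation those of \<delta> for the merged weights.\<close>

lemma sum_insert_after: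
  fixes k :: "nat \<Rightarrow> nat"
  assumes "\<delta> permutes {1..n}" "C \<in> cycles n \<delta>"
  shows "(\<Sum>j\<in>insert_after i (Suc n) C. k j) = (\<Sum>j\<in>C. (k(i := k i + k (Suc n))) j)"
proof -
  have sub: "C \<subseteq> {1..n}" by (rule cycles_subset [OF assms])
  then have C: "finite C" "Suc n \<notin> C" using finite_subset by auto
  show ?thesis
  proof (cases "i \<in> C")
    case True
    have "(\<Sum>j\<in>C - {i}. (k(i := k i + k (Suc n))) j) = (\<Sum>j\<in>C - {i}. k j)"
      by (rule sum.cong) auto
    then show ?thesis
      using C True by (simp add: insert_after_def sum.remove [OF C(1) True])
  next
    case False
    then show ?thesis by (auto simp: insert_after_def intro!: sum.cong)
  qed
qed

lemma cycles_Suc: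
  assumes "\<delta> permutes {1..n}"
  shows "cycles (Suc n) \<delta> = insert {Suc n} (cycles n \<delta>)" and "{Suc n} \<notin> cycles n \<delta>"
proof -
  have "\<delta> (Suc n) = Suc n" using assms by (auto simp: permutes_def)
  then have "orbit \<delta> (Suc n) = {Suc n}" by (simp add: orbit_eq_singleton_iff)
  moreover have "{1..Suc n} = insert (Suc n) {1..n}" by auto
  ultimately show "cycles (Suc n) \<delta> = insert {Suc n} (cycles n \<delta>)" by (simp add: cycles_def)
  show "{Suc n} \<notin> cycles n \<delta>" using cycles_subset [OF assms] by fastforce
qed

section \<open>Index sums that close up into one trace per cycle\<close>

lemma sum_PiE_Suc:
  "(\<Sum>k\<in>{1..Suc n} \<rightarrow>\<^sub>E B. f k) = (\<Sum>k\<in>{1..n} \<rightarrow>\<^sub>E B. \<Sum>l\<in>B. f (k(Suc n := l)))"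
  for f :: "(nat \<Rightarrow> 'b) \<Rightarrow> 'a::comm_monoid_add"
proof -
  have ins: "{1..Suc n} = insert (Suc n) {1..n}" by auto
  have "(\<Sum>k\<in>{1..Suc n} \<rightarrow>\<^sub>E B. f k) = (\<Sum>(l, k)\<in>B \<times> ({1..n} \<rightarrow>\<^sub>E B). f (k(Suc n := l)))"
    unfolding ins PiE_insert_eq
    by (subst sum.reindex [OF inj_combinator]) (auto simp: case_prod_unfold)
  also have "\<dots> = (\<Sum>l\<in>B. \<Sum>k\<in>{1..n} \<rightarrow>\<^sub>E B. f (k(Suc n := l)))"
    by (simp add: sum.cartesian_product)
  finally show ?thesis by (simp add: sum.swap [of _ B])
qed

lemma prod_Suc_remove:
  fixes g :: "nat \<Rightarrow> 'a::comm_monoid_mult"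
  assumes "i \<in> {1..n}"
  shows "prod g {1..Suc n} = g (Suc n) * (g i * prod g ({1..n} - {i}))"
proof -
  have "{1..Suc n} = insert (Suc n) {1..n}" by auto
  then show ?thesis using prod.remove [OF finite_atLeastAtMost assms, of g] by simp
qed

text \<open>Induction on \<open>n\<close>, summing over the last index. If \<phi> fixes
  \<open>Suc n\<close>, this splits off a trace. Otherwise the index joins just two factors, whose
  exponents \<open>k (Suc n)\<close> and \<open>k i\<close> add up: the same merging of weights as
  in \<open>sum_insert_after\<close>.\<close>

lemma sum_PiE_mat_pow:
  assumes I: "finite I" and \<phi>: "\<phi> permutes {1..n}"
  shows "(\<Sum>b\<in>{1..n} \<rightarrow>\<^sub>E I. \<Prod>i=1..n. mat_pow I (k i) (b (\<phi> i)) (b i)) =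
    (\<Prod>C\<in>cycles n \<phi>. mat_tr I (\<Sum>j\<in>C. k j))"
  using \<phi>
proof (induction n arbitrary: \<phi> k)
  case 0
  then show ?case by (simp add: cycles_def)
next
  case (Suc n)
  have upd: "(b(Suc n := c)) j = b j" if "j \<in> {1..n}" for b :: "nat \<Rightarrow> nat" and c j
    using that by auto
  from Suc.prems show ?case
  proof (cases rule: permutes_SucE)
    case 1
    have fix_Suc: "\<phi> (Suc n) = Suc n" using 1 by (auto simp: permutes_def)
    have "(\<Sum>b\<in>{1..Suc n} \<rightarrow>\<^sub>E I. \<Prod>i=1..Suc n. mat_pow I (k i) (b (\<phi> i)) (b i)) =
        (\<Sum>b\<in>{1..n} \<rightarrow>\<^sub>E I. \<Sum>c\<in>I. (\<Prod>i=1..n. mat_pow I (k i) (b (\<phi> i)) (b i)) * mat_pow I (k (Suc n)) c c)"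
      unfolding sum_PiE_Suc
    proof (intro sum.cong refl)
      fix b c
      have "(\<Prod>i=1..n. mat_pow I (k i) ((b(Suc n := c)) (\<phi> i)) ((b(Suc n := c)) i)) =
          (\<Prod>i=1..n. mat_pow I (k i) (b (\<phi> i)) (b i))"
      proof (rule prod.cong [OF refl])
        fix i assume "i \<in> {1..n}"
        moreover from this have "\<phi> i \<in> {1..n}" using permutes_in_image [OF 1] by blast
        ultimately show "mat_pow I (k i) ((b(Suc n := c)) (\<phi> i)) ((b(Suc n := c)) i) = mat_pow I (k i) (b (\<phi> i)) (b i)"
          by (simp only: upd)
      qed
      then show "(\<Prod>i=1..Suc n. mat_pow I (k i) ((b(Suc n := c)) (\<phi> i)) ((b(Suc n := c)) i)) =
          (\<Prod>i=1..n. mat_pow I (k i) (b (\<phi> i)) (b i)) * mat_pow I (k (Suc n)) c c"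
        by (simp add: fix_Suc)
    qed
    also have "\<dots> = (\<Prod>C\<in>cycles n \<phi>. mat_tr I (\<Sum>j\<in>C. k j)) * mat_tr I (k (Suc n))"
      unfolding Suc.IH [OF 1, symmetric] mat_tr_def [of I "k (Suc n)"] sum_product ..
    also have "\<dots> = (\<Prod>C\<in>cycles (Suc n) \<phi>. mat_tr I (\<Sum>j\<in>C. k j))"
      by (simp add: cycles_Suc [OF 1] mult.commute)
    finally show ?thesis .
  next
    case (2 \<phi>' i)
    let ?k = "k(i := k i + k (Suc n))"
    have fix_Suc: "\<phi>' (Suc n) = Suc n" using 2 by (auto simp: permutes_def)
    have i: "i \<noteq> Suc n" "\<phi>' i \<in> {1..n}" using 2 permutes_in_image [OF 2(1)] by auto
    have \<phi>: "\<phi> i = Suc n" "\<phi> (Suc n) = \<phi>' i" "\<And>j. j \<in> {1..n} - {i} \<Longrightarrow> \<phi> j = \<phi>' j"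
      using 2 fix_Suc i by (auto simp: transpose_def)
    have "(\<Sum>b\<in>{1..Suc n} \<rightarrow>\<^sub>E I. \<Prod>j=1..Suc n. mat_pow I (k j) (b (\<phi> j)) (b j)) =
        (\<Sum>b\<in>{1..n} \<rightarrow>\<^sub>E I. \<Sum>c\<in>I. (\<Prod>j\<in>{1..n} - {i}. mat_pow I (k j) (b (\<phi>' j)) (b j)) *
          (mat_pow I (k (Suc n)) (b (\<phi>' i)) c * mat_pow I (k i) c (b i)))"
      unfolding sum_PiE_Suc
    proof (intro sum.cong refl)
      fix b c
      have "(\<Prod>j\<in>{1..n} - {i}. mat_pow I (k j) ((b(Suc n := c)) (\<phi> j)) ((b(Suc n := c)) j)) =
          (\<Prod>j\<in>{1..n} - {i}. mat_pow I (k j) (b (\<phi>' j)) (b j))"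
      proof (rule prod.cong [OF refl])
        fix j assume j: "j \<in> {1..n} - {i}"
        moreover from this have "\<phi>' j \<in> {1..n}" using permutes_in_image [OF 2(1)] by blast
        ultimately show "mat_pow I (k j) ((b(Suc n := c)) (\<phi> j)) ((b(Suc n := c)) j) = mat_pow I (k j) (b (\<phi>' j)) (b j)"
          using upd [of "\<phi>' j"] upd [of j] by (simp only: \<phi> Diff_iff simp_thms)
      qed
      moreover have "(b(Suc n := c)) (\<phi>' i) = b (\<phi>' i)" by (rule upd [OF i(2)])
      ultimately show "(\<Prod>j=1..Suc n. mat_pow I (k j) ((b(Suc n := c)) (\<phi> j)) ((b(Suc n := c)) j)) =
          (\<Prod>j\<in>{1..n} - {i}. mat_pow I (k j) (b (\<phi>' j)) (b j)) *
          (mat_pow I (k (Suc n)) (b (\<phi>' i)) c * mat_pow I (k i) c (b i))"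
        using i unfolding prod_Suc_remove [OF 2(2)] by (simp add: \<phi> ac_simps)
    qed
    also have "\<dots> = (\<Sum>b\<in>{1..n} \<rightarrow>\<^sub>E I. \<Prod>j=1..n. mat_pow I (?k j) (b (\<phi>' j)) (b j))"
    proof (rule sum.cong [OF refl])
      fix b assume "b \<in> {1..n} \<rightarrow>\<^sub>E I"
      then have b: "b i \<in> I" using 2(2) by auto
      have "(\<Sum>c\<in>I. (\<Prod>j\<in>{1..n} - {i}. mat_pow I (k j) (b (\<phi>' j)) (b j)) *
            (mat_pow I (k (Suc n)) (b (\<phi>' i)) c * mat_pow I (k i) c (b i))) =
          (\<Prod>j\<in>{1..n} - {i}. mat_pow I (k j) (b (\<phi>' j)) (b j)) * mat_pow I (k i + k (Suc n)) (b (\<phi>' i)) (b i)"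
        unfolding sum_distrib_left [symmetric] mat_pow_add [OF I b] by (simp add: add.commute)
      also have "\<dots> = (\<Prod>j=1..n. mat_pow I (?k j) (b (\<phi>' j)) (b j))"
        unfolding prod.remove [OF finite_atLeastAtMost 2(2)] by (simp add: mult.commute)
      finally show "(\<Sum>c\<in>I. (\<Prod>j\<in>{1..n} - {i}. mat_pow I (k j) (b (\<phi>' j)) (b j)) *
            (mat_pow I (k (Suc n)) (b (\<phi>' i)) c * mat_pow I (k i) c (b i))) =
          (\<Prod>j=1..n. mat_pow I (?k j) (b (\<phi>' j)) (b j))" .
    qed
    also have "\<dots> = (\<Prod>C\<in>cycles n \<phi>'. mat_tr I (\<Sum>j\<in>C. ?k j))"
      by (rule Suc.IH [OF 2(1)])
    also have "\<dots> = (\<Prod>C\<in>cycles (Suc n) \<phi>. mat_tr I (\<Sum>j\<in>C. k j))"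
      unfolding 2(3) cycles_comp_transpose [OF 2(1,2)]
      by (simp add: prod.reindex [OF inj_on_insert_after_cycles [OF 2(1)]] sum_insert_after [OF 2(1)]
          del: fun_upd_apply)
    finally show ?thesis .
  qed
qed


section \<open>Iterated derivatives\<close>

lemma deriv_p_hat_cong:
  assumes "\<delta> permutes {1..n}" "\<And>j. j \<in> {1..n} \<Longrightarrow> k j = k' j"
  shows "deriv_p_hat n \<delta> k P = deriv_p_hat n \<delta> k' P"
  unfolding deriv_p_hat_def
proof (rule fold_closed_eq [where B = UNIV])
  fix C Q assume "C \<in> cycles n \<delta>"
  then have "C \<subseteq> {1..n}" by (rule cycles_subset [OF assms(1)])
  then have "(\<Sum>j\<in>C. k j) = (\<Sum>j\<in>C. k' j)" using assms(2) by (intro sum.cong) blast+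
  then show "of_nat (\<Sum>j\<in>C. k j) * deriv_p (\<Sum>j\<in>C. k j) Q = of_nat (\<Sum>j\<in>C. k' j) * deriv_p (\<Sum>j\<in>C. k' j) Q"
    by (simp only:)
qed simp_all

lemma deriv_p_hat_Suc:
  assumes "\<delta> permutes {1..n}"
  shows "deriv_p_hat (Suc n) \<delta> k P = of_nat (k (Suc n)) * deriv_p (k (Suc n)) (deriv_p_hat n \<delta> k P)"
proof -
  interpret comp_fun_commute "\<lambda>C Q. of_nat (\<Sum>j\<in>C. k j) * deriv_p (\<Sum>j\<in>C. k j) Q"
    by (rule deriv_p_hat_comp_fun_commute)
  show ?thesis
    unfolding deriv_p_hat_def cycles_Suc(1) [OF assms]
      fold_insert [OF finite_cycles cycles_Suc(2) [OF assms]] by simp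
qed

lemma deriv_p_hat_comp_transpose:
  assumes "\<delta> permutes {1..n}" "i \<in> {1..n}"
  shows "deriv_p_hat (Suc n) (\<delta> \<circ> transpose i (Suc n)) k P =
    deriv_p_hat n \<delta> (k(i := k i + k (Suc n))) P"
  unfolding deriv_p_hat_def cycles_comp_transpose [OF assms]
    fold_image [OF inj_on_insert_after_cycles [OF assms(1)]]
  by (rule fold_closed_eq [where B = UNIV])
     (simp_all only: comp_def sum_insert_after [OF assms(1)] UNIV_I)

text \<open>The sum over the cycle through \<open>i\<close> is at least \<open>k i\<close>, so one
  of the derivatives is with respect to a variable absent from \<open>P\<close>. Hence all sums over
  \<open>k\<close> may be cut off at \<open>K\<close>.\<close>

lemma deriv_p_hat_eq_0:
  assumes "\<delta> permutes {1..n}" "i \<in> {1..n}" "pvars P \<subseteq> {1..K}" "K < k i"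
  shows "deriv_p_hat n \<delta> k P = 0"
proof (rule ccontr)
  assume "deriv_p_hat n \<delta> k P \<noteq> 0"
  then have "(\<Sum>j\<in>orbit \<delta> i. k j) \<in> pvars P"
    using deriv_p_hat_pvars [of n \<delta> k P] assms(2) by (auto simp: cycles_def)
  then have "(\<Sum>j\<in>orbit \<delta> i. k j) \<le> K" using assms(3) by auto
  moreover have "k i \<le> (\<Sum>j\<in>orbit \<delta> i. k j)"
    by (rule member_le_sum [OF cycles_permutes(1) [OF assms(1,2)]])
       (use finite_subset [OF cycles_permutes(2) [OF assms(1,2)]] in auto)
  ultimately show False using assms(4) by simp
qed

text \<open>Two positive numbers with sum at most \<open>K\<close> amount to their sum together with
  a proper cut of it. This compares the two exponents after a cut with the one before it.\<close>

lemma sum_PiE_split_entry: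
  fixes f :: "(nat \<Rightarrow> nat) \<Rightarrow> nat \<Rightarrow> 'a::comm_monoid_add"
  assumes i: "i \<in> A" and A: "finite A"
    and zero: "\<And>k l. k \<in> A \<rightarrow>\<^sub>E {1..K} \<Longrightarrow> l \<in> {1..K} \<Longrightarrow> K < k i + l \<Longrightarrow> f k l = 0"
  shows "(\<Sum>k\<in>A \<rightarrow>\<^sub>E {1..K}. \<Sum>l\<in>{1..K}. f k l) =
    (\<Sum>k\<in>A \<rightarrow>\<^sub>E {1..K}. \<Sum>l\<in>{1..<k i}. f (k(i := k i - l)) l)"
proof -
  have fin: "finite (A \<rightarrow>\<^sub>E {1..K})" using A by (simp add: finite_PiE)
  have "(\<Sum>k\<in>A \<rightarrow>\<^sub>E {1..K}. \<Sum>l\<in>{1..K}. f k l) = (\<Sum>(k, l)\<in>(A \<rightarrow>\<^sub>E {1..K}) \<times> {1..K}. f k l)"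
    by (rule sum.cartesian_product)
  also have "\<dots> = (\<Sum>(k, l)\<in>{(k, l) \<in> (A \<rightarrow>\<^sub>E {1..K}) \<times> {1..K}. k i + l \<le> K}. f k l)"
  proof (rule sum.mono_neutral_right)
    show "\<forall>p\<in>(A \<rightarrow>\<^sub>E {1..K}) \<times> {1..K} - {(k, l) \<in> (A \<rightarrow>\<^sub>E {1..K}) \<times> {1..K}. k i + l \<le> K}.
        (case p of (k, l) \<Rightarrow> f k l) = 0"
      by (auto simp del: atLeastAtMost_iff intro!: zero)
  qed (use fin in auto)
  also have "\<dots> = (\<Sum>(k, l)\<in>Sigma (A \<rightarrow>\<^sub>E {1..K}) (\<lambda>k. {1..<k i}). f (k(i := k i - l)) l)"
  proof (rule sum.reindex_bij_witness [where i = "\<lambda>(k, l). (k(i := k i - l), l)"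
        and j = "\<lambda>(k, l). (k(i := k i + l), l)"], goal_cases)
    case (4 p)
    obtain k l where p: "p = (k, l)" by (cases p)
    have "k i \<le> K" using 4 i by (auto simp: p PiE_iff)
    with 4 i have "k i - l \<le> K" "l \<le> K" by (auto simp: p)
    with 4 i show ?case by (auto simp: p PiE_iff extensional_def)
  qed (use i in \<open>auto simp: PiE_iff extensional_def\<close>)
  also have "\<dots> = (\<Sum>k\<in>A \<rightarrow>\<^sub>E {1..K}. \<Sum>l\<in>{1..<k i}. f (k(i := k i - l)) l)"
    by (rule sum.Sigma [symmetric]) (use fin in auto)
  finally show ?thesis .
qed

text \<open>The positions \<open>(x i, y i)\<close> are arbitrary in \<open>I\<close>, which lets
  the induction add one derivation at a time; the cyclic pattern of \<open>W\<close> is put in only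
  later. Entries of \<open>k\<close> start at 1, so \<open>k i - 1\<close> is a true
  predecessor.\<close>

lemma fold_mps_deriv_psubst_mat_tr:
  assumes I: "finite I" and P: "pvars P \<subseteq> {1..K}"
    and "\<And>i. i \<in> {1..n} \<Longrightarrow> x i \<in> I" "\<And>i. i \<in> {1..n} \<Longrightarrow> y i \<in> I"
  shows "Finite_Set.fold (\<lambda>i. mps_deriv (x i, y i)) (psubst (mat_tr I) P) {1..n} =
    (\<Sum>\<delta> | \<delta> permutes {1..n}. \<Sum>k\<in>{1..n} \<rightarrow>\<^sub>E {1..K}.
      (\<Prod>i=1..n. mat_pow I (k i - 1) (y (\<delta> i)) (x i)) * psubst (mat_tr I) (deriv_p_hat n \<delta> k P))"
  using assms(3,4)
proof (induction n)
  case 0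
  then show ?case by (simp add: deriv_p_hat_def cycles_def)
next
  case (Suc n)
  interpret comp_fun_commute "\<lambda>i. mps_deriv (x i, y i) :: xseries \<Rightarrow> xseries"
    by (rule W_deriv_comp_fun_commute)
  let ?F = "psubst (mat_tr I)"
  let ?v = "(x (Suc n), y (Suc n))"
  let ?M = "\<lambda>\<delta> k i. mat_pow I (k i - 1) (y (\<delta> i)) (x i)"
  let ?T = "\<lambda>n \<delta> k. (\<Prod>i=1..n. ?M \<delta> k i) * ?F (deriv_p_hat n \<delta> k P)"
  let ?B = "{1..n} \<rightarrow>\<^sub>E {1..K}"
  have xy: "x (Suc n) \<in> I" "y (Suc n) \<in> I" using Suc.prems by auto
  have upd: "(k(Suc n := l)) j = k j" if "j \<in> {1..n}" for k :: "nat \<Rightarrow> nat" and l j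
    using that by auto
  \<comment> \<open>The new derivation hits the polynomial: the chain rule produces a variable index
    \<open>l\<close>, which becomes the entry of \<open>k\<close> at the new fixed point
    \<open>Suc n\<close>.\<close>
  have dfix: "(\<Prod>i=1..n. ?M \<delta> k i) * mps_deriv ?v (?F (deriv_p_hat n \<delta> k P)) =
      (\<Sum>l\<in>{1..K}. ?T (Suc n) \<delta> (k(Suc n := l)))" if \<delta>: "\<delta> permutes {1..n}" for \<delta> k
  proof -
    have sub: "pvars (deriv_p_hat n \<delta> k P) \<subseteq> {1..K}"
      using P deriv_p_hat_pvars by blast
    have fix_Suc: "\<delta> (Suc n) = Suc n" using \<delta> by (auto simp: permutes_def)
    have "?T (Suc n) \<delta> (k(Suc n := l)) = (\<Prod>i=1..n. ?M \<delta> k i) *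
        (?F (deriv_p l (deriv_p_hat n \<delta> k P)) * mps_deriv ?v (mat_tr I l))" for l
    proof -
      have "(\<Prod>i=1..n. ?M \<delta> (k(Suc n := l)) i) = (\<Prod>i=1..n. ?M \<delta> k i)"
        by (rule prod.cong) (simp_all only: upd)
      moreover have "deriv_p_hat n \<delta> (k(Suc n := l)) P = deriv_p_hat n \<delta> k P"
        by (rule deriv_p_hat_cong [OF \<delta> upd])
      ultimately show ?thesis
        by (simp add: deriv_p_hat_Suc [OF \<delta>] psubst_mult psubst_of_nat fix_Suc
            mps_deriv_mat_tr [OF I xy] ac_simps)
    qed
    then show ?thesis
      by (simp only: mps_deriv_psubst [OF finite_atLeastAtMost sub] sum_distrib_left)
  qed
  \<comment> \<open>The new derivation cuts the \<open>i\<close>-th matrix power, which inserts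
    \<open>Suc n\<close> into the cycle of \<open>i\<close>.\<close>
  have dins: "(\<Sum>k\<in>?B. mps_deriv ?v (?M \<delta> k i) * prod (?M \<delta> k) ({1..n} - {i}) * ?F (deriv_p_hat n \<delta> k P)) =
      (\<Sum>k\<in>?B. \<Sum>l\<in>{1..K}. ?T (Suc n) (\<delta> \<circ> transpose i (Suc n)) (k(Suc n := l)))"
    if \<delta>: "\<delta> permutes {1..n}" and i: "i \<in> {1..n}" for \<delta> i
  proof -
    let ?\<delta> = "\<delta> \<circ> transpose i (Suc n)"
    have fix_Suc: "\<delta> (Suc n) = Suc n" using \<delta> by (auto simp: permutes_def)
    have \<delta>': "?\<delta> i = Suc n" "?\<delta> (Suc n) = \<delta> i" "\<And>j. j \<in> {1..n} - {i} \<Longrightarrow> ?\<delta> j = \<delta> j"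
      using i fix_Suc by (auto simp: transpose_def)
    \<comment> \<open>The term after a cut: \<open>k i\<close> and \<open>l\<close> belong to the
      points \<open>i\<close> and \<open>Suc n\<close>, and \<open>k i + l\<close> is the entry at
      \<open>i\<close> before the cut.\<close>
    define f where "f k l = mat_pow I (k i - 1) (y (Suc n)) (x i) * mat_pow I (l - 1) (y (\<delta> i)) (x (Suc n)) *
      prod (?M \<delta> k) ({1..n} - {i}) * ?F (deriv_p_hat n \<delta> (k(i := k i + l)) P)" for k and l :: nat
    have T: "?T (Suc n) ?\<delta> (k(Suc n := l)) = f k l" for k l
    proof -
      have "prod (?M ?\<delta> (k(Suc n := l))) ({1..n} - {i}) = prod (?M \<delta> k) ({1..n} - {i})"
        by (rule prod.cong [OF refl]) (simp only: upd \<delta>' Diff_iff simp_thms)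
      moreover have "i \<noteq> Suc n" using i by simp
      moreover have "deriv_p_hat (Suc n) ?\<delta> (k(Suc n := l)) P = deriv_p_hat n \<delta> (k(i := k i + l)) P"
        unfolding deriv_p_hat_comp_transpose [OF \<delta> i]
        by (rule deriv_p_hat_cong [OF \<delta>]) (use i in auto)
      ultimately show ?thesis
        unfolding f_def prod_Suc_remove [OF i]
        by (simp add: \<delta>' ac_simps del: comp_apply)
    qed
    have "(\<Sum>k\<in>?B. \<Sum>l\<in>{1..K}. f k l) = (\<Sum>k\<in>?B. \<Sum>l\<in>{1..<k i}. f (k(i := k i - l)) l)"
    proof (rule sum_PiE_split_entry [OF i finite_atLeastAtMost])
      fix k l assume "K < k i + l"
      then have "deriv_p_hat n \<delta> (k(i := k i + l)) P = 0"
        by (intro deriv_p_hat_eq_0 [OF \<delta> i P]) simp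
      then show "f k l = 0" by (simp add: f_def)
    qed
    also have "\<dots> = (\<Sum>k\<in>?B. mps_deriv ?v (?M \<delta> k i) * prod (?M \<delta> k) ({1..n} - {i}) * ?F (deriv_p_hat n \<delta> k P))"
    proof (rule sum.cong [OF refl])
      fix k assume k: "k \<in> ?B"
      have "f (k(i := k i - l)) l = mat_pow I (l - 1) (y (\<delta> i)) (x (Suc n)) *
          mat_pow I (k i - l - 1) (y (Suc n)) (x i) *
          (prod (?M \<delta> k) ({1..n} - {i}) * ?F (deriv_p_hat n \<delta> k P))" if "l \<in> {1..<k i}" for l
      proof -
        have "prod (?M \<delta> (k(i := k i - l))) ({1..n} - {i}) = prod (?M \<delta> k) ({1..n} - {i})"
          by (rule prod.cong) auto
        moreover have "k(i := k i - l + l) = k" using that by auto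
        ultimately show ?thesis by (simp add: f_def ac_simps)
      qed
      then have "(\<Sum>l\<in>{1..<k i}. f (k(i := k i - l)) l) =
          (\<Sum>l\<in>{1..<k i}. mat_pow I (l - 1) (y (\<delta> i)) (x (Suc n)) * mat_pow I (k i - l - 1) (y (Suc n)) (x i)) *
          (prod (?M \<delta> k) ({1..n} - {i}) * ?F (deriv_p_hat n \<delta> k P))"
        by (simp add: sum_distrib_right)
      \<comment> \<open>With \<open>r = l - 1\<close> factors on the left of the cut, the exponents
        \<open>l - 1\<close> and \<open>k i - l - 1\<close> and the removed factor make up
        \<open>k i - 1\<close>.\<close>
      also have "(\<Sum>l\<in>{1..<k i}. mat_pow I (l - 1) (y (\<delta> i)) (x (Suc n)) * mat_pow I (k i - l - 1) (y (Suc n)) (x i)) =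
          (\<Sum>r<k i - 1. mat_pow I r (y (\<delta> i)) (x (Suc n)) * mat_pow I (k i - 1 - Suc r) (y (Suc n)) (x i))"
        by (rule sum.reindex_bij_witness [where i = Suc and j = "\<lambda>l. l - 1"]) auto
      also have "\<dots> = mps_deriv ?v (?M \<delta> k i)"
        by (rule mps_deriv_mat_pow [OF I xy(1), symmetric])
      finally show "(\<Sum>l\<in>{1..<k i}. f (k(i := k i - l)) l) =
          mps_deriv ?v (?M \<delta> k i) * prod (?M \<delta> k) ({1..n} - {i}) * ?F (deriv_p_hat n \<delta> k P)"
        by (simp only: mult.assoc)
    qed
    finally show ?thesis by (simp only: T)
  qed
  have "{1..Suc n} = insert (Suc n) {1..n}" by auto
  then have "Finite_Set.fold (\<lambda>i. mps_deriv (x i, y i)) (?F P) {1..Suc n} =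
      mps_deriv ?v (Finite_Set.fold (\<lambda>i. mps_deriv (x i, y i)) (?F P) {1..n})"
    by simp
  also have "\<dots> = mps_deriv ?v (\<Sum>\<delta> | \<delta> permutes {1..n}. \<Sum>k\<in>?B. ?T n \<delta> k)"
    using Suc by simp
  also have "\<dots> = (\<Sum>\<delta> | \<delta> permutes {1..n}. (\<Sum>k\<in>?B. (\<Prod>i=1..n. ?M \<delta> k i) * mps_deriv ?v (?F (deriv_p_hat n \<delta> k P))) +
      (\<Sum>i=1..n. \<Sum>k\<in>?B. mps_deriv ?v (?M \<delta> k i) * prod (?M \<delta> k) ({1..n} - {i}) * ?F (deriv_p_hat n \<delta> k P)))"
    unfolding mps_deriv_sum mps_deriv_mult mps_deriv_prod [OF finite_atLeastAtMost] sum_distrib_right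
      sum.distrib sum.swap [of _ _ "{1..n}"] by (simp only: add.commute)
  also have "\<dots> = (\<Sum>\<delta> | \<delta> permutes {1..n}. (\<Sum>k\<in>{1..Suc n} \<rightarrow>\<^sub>E {1..K}. ?T (Suc n) \<delta> k) +
      (\<Sum>i=1..n. \<Sum>k\<in>{1..Suc n} \<rightarrow>\<^sub>E {1..K}. ?T (Suc n) (\<delta> \<circ> transpose i (Suc n)) k))"
    unfolding sum_PiE_Suc
    by (intro sum.cong arg_cong2 [where f = "(+)"] refl dfix dins) simp_all
  also have "\<dots> = (\<Sum>\<delta> | \<delta> permutes {1..Suc n}. \<Sum>k\<in>{1..Suc n} \<rightarrow>\<^sub>E {1..K}. ?T (Suc n) \<delta> k)"
    by (rule sum_permutes_Suc [symmetric])
  finally show ?case .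
qed


section \<open>Truncation to finitely many indices\<close>

text \<open>The homomorphism setting an indeterminate to 0 when one of its indices exceeds
  \<open>N\<close>.\<close>

definition truncate_mps :: "nat \<Rightarrow> xseries \<Rightarrow> xseries"
  where "truncate_mps N f = Abs_mps (\<lambda>m. if Poly_Mapping.keys m \<subseteq> {..N} \<times> {..N} then mps_coeff f m else 0)"

lemma mps_coeff_truncate:
  "mps_coeff (truncate_mps N f) m = (if Poly_Mapping.keys m \<subseteq> {..N} \<times> {..N} then mps_coeff f m else 0)"
  by (simp add: truncate_mps_def)

lemma keys_add_nat: "Poly_Mapping.keys (m + m') = Poly_Mapping.keys m \<union> Poly_Mapping.keys m'"
  for m m' :: "'v \<Rightarrow>\<^sub>0 nat"
  by (auto simp: in_keys_iff lookup_add)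

lemma truncate_mps_mult: "truncate_mps N (f * g) = truncate_mps N f * truncate_mps N g"
proof (rule mps_eqI)
  fix m
  let ?in = "\<lambda>m. Poly_Mapping.keys m \<subseteq> {..N} \<times> {..N}"
  have "(\<Sum>(m1, m2)\<in>splits m. mps_coeff (truncate_mps N f) m1 * mps_coeff (truncate_mps N g) m2) =
      (\<Sum>(m1, m2)\<in>splits m. if ?in m then mps_coeff f m1 * mps_coeff g m2 else 0)"
  proof (rule sum.cong [OF refl], clarify)
    fix m1 m2 assume "(m1, m2) \<in> splits m"
    then have "?in m \<longleftrightarrow> ?in m1 \<and> ?in m2"
      by (auto simp: splits_def keys_add_nat)
    then show "mps_coeff (truncate_mps N f) m1 * mps_coeff (truncate_mps N g) m2 =
        (if ?in m then mps_coeff f m1 * mps_coeff g m2 else 0)"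
      by (simp add: mps_coeff_truncate)
  qed
  then show "mps_coeff (truncate_mps N (f * g)) m = mps_coeff (truncate_mps N f * truncate_mps N g) m"
    by (simp add: mps_coeff_mult mps_coeff_truncate)
qed

lemma truncate_mps_0 [simp]: "truncate_mps N 0 = 0"
  by (rule mps_eqI) (simp add: mps_coeff_truncate)

lemma truncate_mps_const [simp]: "truncate_mps N (mps_const c) = mps_const c"
  by (rule mps_eqI) (auto simp: mps_coeff_truncate mps_const_def)

lemma truncate_mps_1 [simp]: "truncate_mps N 1 = 1"
  using truncate_mps_const [of N 1] by simp

lemma truncate_mps_add: "truncate_mps N (f + g) = truncate_mps N f + truncate_mps N g"
  by (rule mps_eqI) (simp add: mps_coeff_truncate)

lemma truncate_mps_finite_sum: "truncate_mps N (sum f A) = (\<Sum>i\<in>A. truncate_mps N (f i))"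
  by (induction A rule: infinite_finite_induct) (auto simp: truncate_mps_add)

lemma truncate_mps_prod: "truncate_mps N (prod f A) = (\<Prod>i\<in>A. truncate_mps N (f i))"
  by (induction A rule: infinite_finite_induct) (auto simp: truncate_mps_mult)

lemma truncate_mps_power: "truncate_mps N (f ^ n) = truncate_mps N f ^ n"
  by (induction n) (auto simp: truncate_mps_mult)

lemma truncate_mps_Xvar:
  "truncate_mps N (Xvar a b) = (if a \<le> N \<and> b \<le> N then Xvar a b else 0)"
  by (rule mps_eqI) (auto simp: mps_coeff_truncate Xvar_def mps_var_def)

text \<open>Multiplying a monomial by a retained indeterminate does not change whether it is
  retained. For a discarded one this breaks down: the derivative of that indeterminate itself is
  1.\<close>

lemma truncate_mps_deriv:
  assumes "x \<le> N" "y \<le> N"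
  shows "truncate_mps N (mps_deriv (x, y) f) = mps_deriv (x, y) (truncate_mps N f)"
  using assms by (intro mps_eqI) (simp add: mps_coeff_truncate mps_coeff_deriv keys_add_nat)

lemma truncate_mps_sum:
  assumes "finite B" "B \<subseteq> A" "\<And>i. i \<in> A - B \<Longrightarrow> truncate_mps N (f i) = 0"
  shows "truncate_mps N (mps_sum f A) = (\<Sum>i\<in>B. truncate_mps N (f i))"
proof (rule mps_eqI)
  fix m
  show "mps_coeff (truncate_mps N (mps_sum f A)) m = mps_coeff (\<Sum>i\<in>B. truncate_mps N (f i)) m"
  proof (cases "Poly_Mapping.keys m \<subseteq> {..N} \<times> {..N}")
    case True
    then have coeff: "mps_coeff (f i) m = mps_coeff (truncate_mps N (f i)) m" for i
      by (simp add: mps_coeff_truncate)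
    have "mps_coeff (f i) m = 0" if "i \<in> A - B" for i
      using assms(3) [OF that] by (simp add: coeff)
    then have "sum' (\<lambda>i. mps_coeff (f i) m) A = sum' (\<lambda>i. mps_coeff (f i) m) B"
      by (intro sum.mono_neutral_right' assms) simp
    also have "\<dots> = (\<Sum>i\<in>B. mps_coeff (truncate_mps N (f i)) m)"
      using assms(1) by (simp add: coeff)
    finally show ?thesis using True by (simp add: mps_coeff_truncate [of _ "mps_sum f A"] mps_coeff_sum) (simp add: mps_sum_def)
  next
    case False
    then show ?thesis unfolding mps_coeff_sum mps_coeff_truncate by simp
  qed
qed

section \<open>Truncation of matrix powers, of power sums and of \<open>W d\<close>\<close>

lemma truncate_X_power:
  assumes "a \<in> {1..N}"
  shows "b \<in> {1..N} \<Longrightarrow> truncate_mps N (X_power k a b) = mat_pow {1..N} k a b"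
proof (induction k arbitrary: b)
  case (Suc k)
  have "truncate_mps N (X_power (Suc k) a b) = (\<Sum>c\<in>{1..N}. truncate_mps N (X_power k a c * Xvar c b))"
    unfolding X_power.simps
    by (rule truncate_mps_sum) (auto simp: truncate_mps_mult truncate_mps_Xvar)
  also have "\<dots> = mat_pow {1..N} (Suc k) a b"
    unfolding mat_pow.simps
    by (rule sum.cong) (use Suc in \<open>auto simp: truncate_mps_mult truncate_mps_Xvar\<close>)
  finally show ?case .
qed simp

text \<open>Diagonal entries beyond \<open>N\<close> end in an indeterminate that is set to 0. For
  \<open>k = 0\<close> the two sides differ in general: \<open>power_sum 0\<close> is 0 by the
  convention of \<open>sum'\<close>, while \<open>mat_tr {1..N} 0\<close> is
  \<open>N\<close>.\<close>

lemma truncate_power_sum: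
  assumes "k \<ge> 1"
  shows "truncate_mps N (power_sum k) = mat_tr {1..N} k"
proof -
  obtain l where k: "k = Suc l" using assms by (cases k) auto
  have "truncate_mps N (X_power k a a) = 0" if "a \<in> {1..} - {1..N}" for a
    using that unfolding k X_power.simps
    by (subst truncate_mps_sum [of "{}"]) (auto simp: truncate_mps_mult truncate_mps_Xvar)
  then have "truncate_mps N (power_sum k) = (\<Sum>a\<in>{1..N}. truncate_mps N (X_power k a a))"
    unfolding power_sum_def by (intro truncate_mps_sum) auto
  also have "\<dots> = mat_tr {1..N} k"
    unfolding mat_tr_def by (rule sum.cong) (simp_all add: truncate_X_power)
  finally show ?thesis .
qed

lemma truncate_to_xseries:
  assumes "P \<in> p_ring"
  shows "truncate_mps N (to_xseries P) = psubst (mat_tr {1..N}) P"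
proof -
  have "truncate_mps N (power_sum k) = mat_tr {1..N} k"
    if "m \<in> Poly_Mapping.keys P" "k \<in> Poly_Mapping.keys m" for m k
  proof (rule truncate_power_sum)
    have "k \<in> pvars P" using that by (auto simp: pvars_def)
    then have "0 < k" using assms by (auto simp: p_ring_def intro!: gr0I)
    then show "k \<ge> 1" by simp
  qed
  then show ?thesis
    unfolding to_xseries_def psubst_def
    by (auto simp: truncate_mps_finite_sum truncate_mps_mult truncate_mps_prod truncate_mps_power
        intro!: sum.cong arg_cong2 [where f = "(*)"] prod.cong)
qed

lemma truncate_W_deriv:
  assumes "a \<in> {1..d} \<rightarrow>\<^sub>E {1..N}" "e \<in> {1..d} \<rightarrow>\<^sub>E {1..N}"
  shows "truncate_mps N (W_deriv d a e f) = W_deriv d a e (truncate_mps N f)"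
proof -
  let ?v = "\<lambda>i. ((a(Suc d := a 1)) (Suc i), e i)"
  interpret comp_fun_commute "\<lambda>i. mps_deriv (?v i) :: xseries \<Rightarrow> xseries"
    by (rule W_deriv_comp_fun_commute)
  have "truncate_mps N (Finite_Set.fold (\<lambda>i. mps_deriv (?v i)) f A) =
      Finite_Set.fold (\<lambda>i. mps_deriv (?v i)) (truncate_mps N f) A" if "finite A" "A \<subseteq> {1..d}" for A
    using that
  proof induction
    case (insert i A)
    \<comment> \<open>The case \<open>i = d\<close> is set apart because there the row index is
      \<open>a 1\<close>.\<close>
    have "a (Suc i) \<le> N" if "i \<noteq> d" using assms insert.prems that by (auto simp: PiE_iff)
    moreover have "a 1 \<le> N" "e i \<le> N" using assms insert.prems by (auto simp: PiE_iff)
    ultimately have "fst (?v i) \<le> N" "snd (?v i) \<le> N" by auto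
    then have "truncate_mps N (mps_deriv (?v i) g) = mps_deriv (?v i) (truncate_mps N g)" for g
      by (metis truncate_mps_deriv prod.collapse)
    then show ?case
      using insert by (simp only: fold_insert [OF insert.hyps] insert_subset simp_thms)
  qed simp
  then show ?thesis unfolding W_deriv_def by simp
qed

text \<open>A summand with an index above \<open>N\<close> contains an indeterminate that is set to
  0; in the others all derivations are with respect to retained indeterminates.\<close>

lemma truncate_W:
  "truncate_mps N (W d f) = mps_const (1 / of_nat d) *
    (\<Sum>(a, e)\<in>({1..d} \<rightarrow>\<^sub>E {1..N}) \<times> ({1..d} \<rightarrow>\<^sub>E {1..N}).
      (\<Prod>i=1..d. Xvar (a i) (e i)) * W_deriv d a e (truncate_mps N f))"
proof -
  let ?A = "({1..d} \<rightarrow>\<^sub>E {1..}) \<times> ({1..d} \<rightarrow>\<^sub>E {1..})"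
  let ?B = "({1..d} \<rightarrow>\<^sub>E {1..N}) \<times> ({1..d} \<rightarrow>\<^sub>E {1..N})"
  let ?f = "\<lambda>(a, e). (\<Prod>i=1..d. Xvar (a i) (e i)) * W_deriv d a e f"
  have zero: "truncate_mps N (?f p) = 0" if p: "p \<in> ?A - ?B" for p
  proof -
    obtain a e where ae: "p = (a, e)" by (cases p)
    have "\<exists>i\<in>{1..d}. \<not> (a i \<le> N \<and> e i \<le> N)"
      using p by (rule contrapos_pp) (auto simp: ae PiE_iff)
    then obtain i where i: "i \<in> {1..d}" "\<not> (a i \<le> N \<and> e i \<le> N)" by blast
    then have "truncate_mps N (Xvar (a i) (e i)) = 0" by (auto simp: truncate_mps_Xvar)
    then have "(\<Prod>i=1..d. truncate_mps N (Xvar (a i) (e i))) = 0"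
      using i(1) by (intro prod_zero) auto
    then show ?thesis by (simp add: ae truncate_mps_mult truncate_mps_prod)
  qed
  have "truncate_mps N (mps_sum ?f ?A) = (\<Sum>p\<in>?B. truncate_mps N (?f p))"
    by (rule truncate_mps_sum [OF _ _ zero]) (auto simp: PiE_iff intro!: finite_PiE)
  also have "\<dots> = (\<Sum>(a, e)\<in>?B. (\<Prod>i=1..d. Xvar (a i) (e i)) * W_deriv d a e (truncate_mps N f))"
  proof (rule sum.cong [OF refl], clarify)
    fix a e assume ae: "a \<in> {1..d} \<rightarrow>\<^sub>E {1..N}" "e \<in> {1..d} \<rightarrow>\<^sub>E {1..N}"
    then have "(\<Prod>i=1..d. truncate_mps N (Xvar (a i) (e i))) = (\<Prod>i=1..d. Xvar (a i) (e i))"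
      by (intro prod.cong) (auto simp: truncate_mps_Xvar PiE_iff)
    then show "truncate_mps N ((\<Prod>i=1..d. Xvar (a i) (e i)) * W_deriv d a e f) =
        (\<Prod>i=1..d. Xvar (a i) (e i)) * W_deriv d a e (truncate_mps N f)"
      by (simp add: truncate_mps_mult truncate_mps_prod truncate_W_deriv [OF ae])
  qed
  finally show ?thesis unfolding W_def truncate_mps_mult truncate_mps_const by simp
qed


section \<open>Comparison of the two operators\<close>

lemma sum_PiE_permute:
  fixes f :: "('i \<Rightarrow> 'b) \<Rightarrow> 'a::comm_monoid_add"
  assumes "\<pi> permutes A"
  shows "(\<Sum>a\<in>A \<rightarrow>\<^sub>E B. f a) = (\<Sum>b\<in>A \<rightarrow>\<^sub>E B. f (b \<circ> \<pi>))"
proof (rule sum.reindex_bij_witness [where i = "\<lambda>b. b \<circ> \<pi>" and j = "\<lambda>a. a \<circ> inv \<pi>"])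
  have comp: "b \<circ> \<rho> \<in> A \<rightarrow>\<^sub>E B" if "\<rho> permutes A" "b \<in> A \<rightarrow>\<^sub>E B" for \<rho> b
    using that permutes_in_image [OF that(1)] by (auto simp: PiE_iff extensional_def)
  show "a \<circ> inv \<pi> \<in> A \<rightarrow>\<^sub>E B" if "a \<in> A \<rightarrow>\<^sub>E B" for a
    by (rule comp [OF permutes_inv [OF assms] that])
  show "b \<circ> \<pi> \<in> A \<rightarrow>\<^sub>E B" if "b \<in> A \<rightarrow>\<^sub>E B" for b
    by (rule comp [OF assms that])
qed (simp_all add: o_assoc [symmetric] permutes_inv_o [OF assms])

text \<open>Summing over \<open>e\<close> glues each \<open>X\<close> to the matrix power following it; writing
  \<open>a\<^sub>i = b\<^sub>i\<^sub>-\<^sub>1\<close> then turns the index \<open>a (\<delta> i)\<close> into \<open>b (phi d \<delta> i)\<close>.\<close>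

lemma sum_Xvar_mat_pow:
  assumes I: "finite I" and d: "d \<ge> 1" and \<delta>: "\<delta> permutes {1..d}"
    and k: "\<And>i. i \<in> {1..d} \<Longrightarrow> k i \<ge> 1"
  shows "(\<Sum>a\<in>{1..d} \<rightarrow>\<^sub>E I. \<Sum>e\<in>{1..d} \<rightarrow>\<^sub>E I. (\<Prod>i=1..d. Xvar (a i) (e i)) *
      (\<Prod>i=1..d. mat_pow I (k i - 1) (e (\<delta> i)) ((a(Suc d := a 1)) (Suc i)))) =
    (\<Prod>C\<in>cycles d (phi d \<delta>). mat_tr I (\<Sum>j\<in>C. k j))"
proof -
  let ?a' = "\<lambda>a :: nat \<Rightarrow> nat. a(Suc d := a 1)"
  have a': "?a' a (Suc i) \<in> I" if "a \<in> {1..d} \<rightarrow>\<^sub>E I" "i \<in> {1..d}" for a i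
    using that d by (auto simp: PiE_iff)
  have "(\<Sum>e\<in>{1..d} \<rightarrow>\<^sub>E I. (\<Prod>i=1..d. Xvar (a i) (e i)) *
        (\<Prod>i=1..d. mat_pow I (k i - 1) (e (\<delta> i)) (?a' a (Suc i)))) =
      (\<Prod>i=1..d. mat_pow I (k i) (a (\<delta> i)) (?a' a (Suc i)))" if a: "a \<in> {1..d} \<rightarrow>\<^sub>E I" for a
  proof -
    \<comment> \<open>After this reindexing the indeterminate ending in
      \<open>e (\<delta> i)\<close> stands next to the power starting there. Renaming
      \<open>e \<circ> \<delta>\<close> as \<open>e\<close> makes the sum over \<open>e\<close> a
      product of sums over single indices.\<close>
    have "(\<Prod>i=1..d. Xvar (a i) (e i)) = (\<Prod>i=1..d. Xvar (a (\<delta> i)) (e (\<delta> i)))" for e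
      by (rule prod.permute [OF \<delta>, unfolded comp_def])
    then have "(\<Sum>e\<in>{1..d} \<rightarrow>\<^sub>E I. (\<Prod>i=1..d. Xvar (a i) (e i)) *
          (\<Prod>i=1..d. mat_pow I (k i - 1) (e (\<delta> i)) (?a' a (Suc i)))) =
        (\<Sum>e\<in>{1..d} \<rightarrow>\<^sub>E I. \<Prod>i=1..d. Xvar (a (\<delta> i)) ((e \<circ> \<delta>) i) *
          mat_pow I (k i - 1) ((e \<circ> \<delta>) i) (?a' a (Suc i)))"
      by (simp only: prod.distrib comp_def)
    also have "\<dots> = (\<Sum>e\<in>{1..d} \<rightarrow>\<^sub>E I. \<Prod>i=1..d. Xvar (a (\<delta> i)) (e i) *
          mat_pow I (k i - 1) (e i) (?a' a (Suc i)))"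
      by (rule sum_PiE_permute [OF \<delta>, symmetric])
    also have "\<dots> = (\<Prod>i=1..d. \<Sum>c\<in>I. Xvar (a (\<delta> i)) c * mat_pow I (k i - 1) c (?a' a (Suc i)))"
      by (rule prod_sum_PiE [symmetric]) (use I in simp_all)
    also have "\<dots> = (\<Prod>i=1..d. mat_pow I (k i) (a (\<delta> i)) (?a' a (Suc i)))"
    proof (rule prod.cong [OF refl])
      fix i assume i: "i \<in> {1..d}"
      then have "\<delta> i \<in> {1..d}" using permutes_in_image [OF \<delta>] by blast
      then have "a (\<delta> i) \<in> I" using a by auto
      moreover have "Suc (k i - 1) = k i" using k [OF i] by simp
      ultimately show "(\<Sum>c\<in>I. Xvar (a (\<delta> i)) c * mat_pow I (k i - 1) c (?a' a (Suc i))) =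
          mat_pow I (k i) (a (\<delta> i)) (?a' a (Suc i))"
        using mat_pow_Suc_left [OF I _ a' [OF a i]] by metis
    qed
    finally show ?thesis .
  qed
  then have "(\<Sum>a\<in>{1..d} \<rightarrow>\<^sub>E I. \<Sum>e\<in>{1..d} \<rightarrow>\<^sub>E I. (\<Prod>i=1..d. Xvar (a i) (e i)) *
        (\<Prod>i=1..d. mat_pow I (k i - 1) (e (\<delta> i)) (?a' a (Suc i)))) =
      (\<Sum>a\<in>{1..d} \<rightarrow>\<^sub>E I. \<Prod>i=1..d. mat_pow I (k i) (a (\<delta> i)) (?a' a (Suc i)))"
    by (rule sum.cong [OF refl])
  also have "\<dots> = (\<Sum>b\<in>{1..d} \<rightarrow>\<^sub>E I. \<Prod>i=1..d. mat_pow I (k i) (b (phi d \<delta> i)) (b i))"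
  proof -
    let ?\<pi> = "cycle_of_list (rev [1..<Suc d])"
    have "set (rev [1..<Suc d]) = {1..d}" by auto
    then have \<pi>: "?\<pi> permutes {1..d}" using cycle_permutes [of "rev [1..<Suc d]"] by metis
    \<comment> \<open>The long cycle sends \<open>Suc i\<close> to \<open>i\<close> for
      \<open>i < d\<close>; for \<open>i = d\<close> the convention replaces \<open>Suc d\<close> by
      1, which is sent to \<open>d\<close>.\<close>
    have "?a' (b \<circ> ?\<pi>) (Suc i) = b i" if "i \<in> {1..d}" for b :: "nat \<Rightarrow> nat" and i
      using that d long_cycle_apply [of 1 d] long_cycle_apply [of "Suc i" d] by auto
    then show ?thesis
      by (subst sum_PiE_permute [OF \<pi>])
         (auto simp: phi_def simp del: fun_upd_apply intro!: sum.cong prod.cong)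
  qed
  also have "\<dots> = (\<Prod>C\<in>cycles d (phi d \<delta>). mat_tr I (\<Sum>j\<in>C. k j))"
    by (rule sum_PiE_mat_pow [OF I phi_permutes [OF \<delta>]])
  finally show ?thesis .
qed

text \<open>Entries of \<open>k\<close> above \<open>K\<close> contribute 0, so \<open>sum'\<close>
  becomes a finite sum, through which the ring homomorphism \<open>psubst g\<close> passes.\<close>

lemma psubst_Delta:
  assumes "pvars P \<subseteq> {1..K}"
  shows "psubst g (Delta d P) = mps_const (1 / of_nat d) *
    (\<Sum>\<delta> | \<delta> permutes {1..d}. \<Sum>k\<in>{1..d} \<rightarrow>\<^sub>E {1..K}.
      (\<Prod>C\<in>cycles d (phi d \<delta>). g (\<Sum>j\<in>C. k j)) * psubst g (deriv_p_hat d \<delta> k P))"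
proof -
  have "sum' (\<lambda>k. p_hat d (phi d \<delta>) k * deriv_p_hat d \<delta> k P) ({1..d} \<rightarrow>\<^sub>E {1..}) =
      (\<Sum>k\<in>{1..d} \<rightarrow>\<^sub>E {1..K}. p_hat d (phi d \<delta>) k * deriv_p_hat d \<delta> k P)" if \<delta>: "\<delta> permutes {1..d}" for \<delta>
  proof -
    have "deriv_p_hat d \<delta> k P = 0" if "k \<in> ({1..d} \<rightarrow>\<^sub>E {1..}) - ({1..d} \<rightarrow>\<^sub>E {1..K})" for k
    proof -
      have "\<exists>i\<in>{1..d}. K < k i"
        using that by (rule contrapos_pp) (auto simp: PiE_iff not_less)
      then obtain i where "i \<in> {1..d}" "K < k i" by blast
      then show ?thesis by (intro deriv_p_hat_eq_0 [OF \<delta> _ assms])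
    qed
    then have "sum' (\<lambda>k. p_hat d (phi d \<delta>) k * deriv_p_hat d \<delta> k P) ({1..d} \<rightarrow>\<^sub>E {1..}) =
        sum' (\<lambda>k. p_hat d (phi d \<delta>) k * deriv_p_hat d \<delta> k P) ({1..d} \<rightarrow>\<^sub>E {1..K})"
      by (intro sum.mono_neutral_right' PiE_mono) (simp_all add: Ball_def)
    then show ?thesis by (simp add: finite_PiE)
  qed
  then show ?thesis
    unfolding Delta_def by (simp add: psubst_mult psubst_sum p_hat_def psubst_prod psubst_pvar)
qed

text \<open>The identity of the two operators for a finite matrix: expand each
  \<open>W_deriv\<close>, move the sums over \<open>a\<close> and \<open>e\<close> inside those over
  \<delta> and \<open>k\<close>, and evaluate them by \<open>sum_Xvar_mat_pow\<close>.\<close>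

lemma psubst_mat_tr_Delta:
  assumes I: "finite I" and d: "d \<ge> 1" and P: "P \<in> p_ring"
  shows "psubst (mat_tr I) (Delta d P) = mps_const (1 / of_nat d) *
    (\<Sum>(a, e)\<in>({1..d} \<rightarrow>\<^sub>E I) \<times> ({1..d} \<rightarrow>\<^sub>E I).
      (\<Prod>i=1..d. Xvar (a i) (e i)) * W_deriv d a e (psubst (mat_tr I) P))"
proof -
  let ?A = "{1..d} \<rightarrow>\<^sub>E I"
  let ?S = "{\<delta>. \<delta> permutes {1..d}}"
  let ?a' = "\<lambda>a :: nat \<Rightarrow> nat. a(Suc d := a 1)"
  \<comment> \<open>The inserted 0 keeps the maximum defined when \<open>P\<close> is
    constant.\<close>
  define K where "K = Max (insert 0 (pvars P))"
  have fin: "finite (pvars P)" by (simp add: pvars_def)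
  have K: "pvars P \<subseteq> {1..K}"
  proof
    fix j assume j: "j \<in> pvars P"
    then have "0 < j" using P by (auto simp: p_ring_def intro!: gr0I)
    moreover have "j \<le> K" using fin j by (simp add: K_def)
    ultimately show "j \<in> {1..K}" by simp
  qed
  let ?D = "\<lambda>\<delta> k. psubst (mat_tr I) (deriv_p_hat d \<delta> k P)"
  let ?M = "\<lambda>a e \<delta> k. \<Prod>i=1..d. mat_pow I (k i - 1) (e (\<delta> i)) (?a' a (Suc i))"
  let ?B = "{1..d} \<rightarrow>\<^sub>E {1..K}"
  have W: "W_deriv d a e (psubst (mat_tr I) P) = (\<Sum>\<delta>\<in>?S. \<Sum>k\<in>?B. ?M a e \<delta> k * ?D \<delta> k)"
    if "a \<in> ?A" "e \<in> ?A" for a e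
    unfolding W_deriv_def
    by (rule fold_mps_deriv_psubst_mat_tr [OF I K]) (use that d in \<open>auto simp: PiE_iff\<close>)
  have "(\<Sum>(a, e)\<in>?A \<times> ?A. (\<Prod>i=1..d. Xvar (a i) (e i)) * W_deriv d a e (psubst (mat_tr I) P)) =
      (\<Sum>(a, e)\<in>?A \<times> ?A. \<Sum>\<delta>\<in>?S. \<Sum>k\<in>?B. ((\<Prod>i=1..d. Xvar (a i) (e i)) * ?M a e \<delta> k) * ?D \<delta> k)"
    by (rule sum.cong) (auto simp: W sum_distrib_left mult.assoc simp del: fun_upd_apply)
  also have "\<dots> = (\<Sum>\<delta>\<in>?S. \<Sum>k\<in>?B. (\<Sum>(a, e)\<in>?A \<times> ?A. (\<Prod>i=1..d. Xvar (a i) (e i)) * ?M a e \<delta> k) * ?D \<delta> k)"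
    unfolding case_prod_unfold sum.swap [of _ _ "?A \<times> ?A"] sum_distrib_right ..
  also have "\<dots> = (\<Sum>\<delta>\<in>?S. \<Sum>k\<in>?B. (\<Prod>C\<in>cycles d (phi d \<delta>). mat_tr I (\<Sum>j\<in>C. k j)) * ?D \<delta> k)"
  proof (intro sum.cong refl arg_cong2 [where f = "(*)"])
    fix \<delta> k assume "\<delta> \<in> ?S" "k \<in> ?B"
    then show "(\<Sum>(a, e)\<in>?A \<times> ?A. (\<Prod>i=1..d. Xvar (a i) (e i)) * ?M a e \<delta> k) =
        (\<Prod>C\<in>cycles d (phi d \<delta>). mat_tr I (\<Sum>j\<in>C. k j))"
      unfolding sum.cartesian_product [symmetric]
      by (intro sum_Xvar_mat_pow I d) auto
  qed
  finally show ?thesis by (simp only: psubst_Delta [OF K])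
qed

theorem theorem4p41:
  fixes d :: nat
  assumes "d \<ge> 1"
  shows "\<forall>P \<in> p_ring. to_xseries (Delta d P) = W d (to_xseries P)"
proof (intro ballI mps_eqI)
  fix P and m :: "nat \<times> nat \<Rightarrow>\<^sub>0 nat" assume P: "P \<in> p_ring"
  \<comment> \<open>All indices occurring in \<open>m\<close> are at most \<open>N\<close>, so
    truncation at \<open>N\<close> keeps the coefficient of \<open>m\<close>.\<close>
  define N where "N = Max (insert 0 (fst ` Poly_Mapping.keys m \<union> snd ` Poly_Mapping.keys m))"
  have "a \<le> N \<and> b \<le> N" if "(a, b) \<in> Poly_Mapping.keys m" for a b
    unfolding N_def using that by (intro conjI Max_ge) force+
  then have "Poly_Mapping.keys m \<subseteq> {..N} \<times> {..N}" by auto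
  then have coeff: "mps_coeff f m = mps_coeff (truncate_mps N f) m" for f
    by (simp add: mps_coeff_truncate)
  have "truncate_mps N (to_xseries (Delta d P)) = truncate_mps N (W d (to_xseries P))"
    unfolding truncate_W truncate_to_xseries [OF P] truncate_to_xseries [OF Delta_in_p_ring [OF P]]
    by (rule psubst_mat_tr_Delta [OF finite_atLeastAtMost assms P])
  then show "mps_coeff (to_xseries (Delta d P)) m = mps_coeff (W d (to_xseries P)) m"
    unfolding coeff [of "to_xseries _"] coeff [of "W _ _"] by simp
qed

end
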